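(* Let $\|\cdot\|$ be a norm on $\mathbb{R}^d$, $\mathcal{X}\subseteq\mathbb{R}^d$ closed convex, $S,S_1,\dots,S_n$ i.i.d. ($n\ge2$), $f(x;S)$ convex in $x$, $f_i=f(\cdot;S_i)$, $F(x)=\mathbb{E}[f(x;S)]$, $\bar F(x)=\frac1n\sum_{i=1}^nf_i(x)$, $F^\star=\inf_{x\in\mathcal{X}}F(x)$. Suppose $f$ is $L$-Lipschitz and $\hat L\ge L$ is known. Let $x_0=0$ and $x_1,\dots,x_K\in\mathcal{X}$ be fixed candidate points (not depending on $S_1,\dots,S_n$). Let $\delta\in(0,1)$, $\tilde c=\ln\frac{4K}{\delta}$, and for $k\in\{0,\dots,K\}$ \[ \tau_k=\sqrt{\frac{2\tilde c\, s_k^2}{n}}+\tilde c\,\frac{14\hat L\|x_k\|}{3(n-1)},\qquad s_k^2=\frac{1}{n-1}\sum_{i=1}^n\big(f_i(x_k)-f_i(0)-(\bar F(x_k)-\bar F(0))\big)^2 . \] Let $\gamma\in[1,\infty)$ and let $k_{\mathrm{rely}}$ be the output of Reliable Model Selection run with these $\tau_k$. Then, with probability $1-\delta$, for every $k\in\{0,\dots,K\}$, \[ F(x_{k_{\mathrm{rely}}})\le F(x_k)+(1+\gamma)\left(\sqrt{2\tilde c}\,\frac{L\|x_k\|}{\sqrt n}+\frac{14\tilde c}{3}\cdot\frac{\hat L\|x_k\|}{n}\right). \] Additionally, if $F$ is $\mu$-strongly convex and $\gamma\ge3$, then with probability $1-\delta$, \[ F(x_{k_{\mathrm{rely}}})-F^\star\le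 4\Big(\min_{k\in\{0,\dots,K\}}F(x_k)-F^\star\Big)+\frac{128}{\mu}\left(2L\sqrt{\frac{2\tilde c}{n-1}}+\frac{14\hat L\tilde c}{3n}\right)^2 . \]
   Context: $f$ is $L$-Lipschitz means that almost surely $|f(x;S)-f(x';S)|\le L\|x-x'\|$ for all $x,x'\in\mathcal{X}$. $F$ is $\mu$-strongly convex means $F(u)\ge F(v)+g\cdot(u-v)+\frac\mu2\|u-v\|^2$ for all $u,v\in\mathcal{X}$ and subgradients $g$ of $F$ at $v$. Reliable Model Selection with parameter $\gamma$: set $\theta=\min_{k}\bar F(x_k)+\gamma\tau_k$, $\mathcal{F}=\{k:\bar F(x_k)+\tau_k\le\theta\}$, and output $k_{\mathrm{rely}}\in\arg\min_{k\in\mathcal{F}}\bar F(x_k)$ (all indices range over $\{0,\dots,K\}$; note $\tau_0=0$ since $x_0=0$). *)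

theory Defs
  imports "HOL-Probability.Probability"
begin

definition is_norm :: "('a::real_vector \<Rightarrow> real) \<Rightarrow> bool" where
  "is_norm N \<longleftrightarrow> (\<forall>x. N x = 0 \<longleftrightarrow> x = 0) \<and> (\<forall>x y. N (x + y) \<le> N x + N y)
                 \<and> (\<forall>c x. N (c *\<^sub>R x) = \<bar>c\<bar> * N x)"

definition Fbar :: "('a \<Rightarrow> 's \<Rightarrow> real) \<Rightarrow> nat \<Rightarrow> (nat \<Rightarrow> 's) \<Rightarrow> 'a \<Rightarrow> real" where
  "Fbar f n S x = (\<Sum>i<n. f x (S i)) / real n"

definition svar :: "('a::zero \<Rightarrow> 's \<Rightarrow> real) \<Rightarrow> nat \<Rightarrow> (nat \<Rightarrow> 's) \<Rightarrow> 'a \<Rightarrow> real" where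
  "svar f n S y = (\<Sum>i<n. (f y (S i) - f 0 (S i) - (Fbar f n S y - Fbar f n S 0))\<^sup>2) / (real n - 1)"

definition tau :: "('a \<Rightarrow> real) \<Rightarrow> real \<Rightarrow> real \<Rightarrow> ('a::zero \<Rightarrow> 's \<Rightarrow> real) \<Rightarrow> nat \<Rightarrow> (nat \<Rightarrow> 's) \<Rightarrow> 'a \<Rightarrow> real" where
  "tau N Lhat c f n S y = sqrt (2 * c * svar f n S y / real n) + c * (14 * Lhat * N y) / (3 * (real n - 1))"

text \<open>Reliable Model Selection with parameter gamma: kr is a (any) valid output,
  given empirical risks Fb k and widths t k for k in {0..K}.\<close>
definition rms_output :: "(nat \<Rightarrow> real) \<Rightarrow> (nat \<Rightarrow> real) \<Rightarrow> real \<Rightarrow> nat \<Rightarrow> nat \<Rightarrow> bool" where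
  "rms_output Fb t \<gamma> K kr \<longleftrightarrow>
     (let \<theta> = Min ((\<lambda>k. Fb k + \<gamma> * t k) ` {..K});
          Feas = {k. k \<le> K \<and> Fb k + t k \<le> \<theta>}
      in kr \<in> Feas \<and> (\<forall>k\<in>Feas. Fb kr \<le> Fb k))"

definition strongly_convex_wrt :: "('a::real_inner \<Rightarrow> real) \<Rightarrow> 'a set \<Rightarrow> ('a \<Rightarrow> real) \<Rightarrow> real \<Rightarrow> bool" where
  "strongly_convex_wrt N X F \<mu> \<longleftrightarrow>
     (\<forall>u\<in>X. \<forall>v\<in>X. \<forall>g. (\<forall>w\<in>X. F w \<ge> F v + g \<bullet> (w - v)) \<longrightarrow>
        F u \<ge> F v + g \<bullet> (u - v) + \<mu> / 2 * (N (u - v))\<^sup>2)"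

end

theory Submission
  imports Defs "HOL-Combinatorics.Permutations"
begin

text \<open>
  The widths \<open>\<tau>\<^sub>k\<close> come from an empirical Bernstein inequality. Bernstein's inequality bounds
  the deviation of the empirical mean by the true standard deviation \<open>\<sigma>\<close>. To replace \<open>\<sigma>\<close> by the sample
  standard deviation, write the sample variance as the average, over all permutations of the sample,
  of sums of \<open>\<lfloor>n/2\<rfloor>\<close> independent terms \<open>(Y\<^sub>a - Y\<^sub>b)\<^sup>2 / 2\<close>; by Jensen its exponential moments are
  dominated by those of one such sum, and nonnegative variables have a sub-Gaussian lower tail.

  On the event that all widths are valid, the selected point is no worse than any candidate up to
  \<open>\<tau>\<close>, because its risk is at most \<open>\<theta>\<close>. For the second bound, compare with the best candidate \<open>k\<^sub>*\<close>:
  deviations and widths are Lipschitz in the candidate, so if \<open>k\<^sub>*\<close> is feasible the loss is linear in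
  the distance to \<open>x\<^bsub>k\<^sub>*\<^esub>\<close>, and if it is infeasible then the candidate attaining \<open>\<theta>\<close> has a width that is
  itself linear in that distance. Quadratic growth around the minimiser of \<open>F\<close> turns linear terms into
  the squared term.
\<close>

section \<open>Bernstein's inequality\<close>

text \<open>Right side minus left side is convex, and its tangent at 0 is the zero line. Keeping
  \<open>1 - y / 3\<close> as a factor avoids a case distinction at \<open>y = 3\<close>.\<close>

lemma exp_le_Bernstein:
  fixes y :: real
  shows "(1 - y / 3) * (exp y - 1 - y) \<le> y\<^sup>2 / 2"
proof -
  define G where "G = (\<lambda>y::real. y\<^sup>2 / 2 - (1 - y / 3) * (exp y - 1 - y))"
  define G' where "G' = (\<lambda>y::real. (y + 2 - 2 * exp y + y * exp y) / 3)"
  have conv: "convex_on UNIV G"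
  proof (rule f''_ge0_imp_convex)
    show "DERIV G t :> G' t" for t
      unfolding G_def G'_def
      by (rule derivative_eq_intros refl | simp add: field_simps)+
    show "DERIV G' t :> (1 - exp t + t * exp t) / 3" for t
      unfolding G'_def
      by (rule derivative_eq_intros refl | simp add: field_simps)+
    show "0 \<le> (1 - exp t + t * exp t) / 3" for t :: real
    proof -
      have "1 - t \<le> exp (-t)"
        using exp_ge_add_one_self[of "-t"] by simp
      then have "(1 - t) * exp t \<le> exp (-t) * exp t"
        by (intro mult_right_mono) auto
      also have "exp (-t) * exp t = 1"
        by (simp add: exp_minus)
      finally show ?thesis
        by (simp add: algebra_simps)
    qed
  qed simp
  have d0: "(G has_real_derivative 0) (at 0 within UNIV)"
    unfolding G_def by (rule derivative_eq_intros refl | simp)+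
  have "0 * (y - 0) \<le> G y - G 0"
    by (rule convex_on_imp_above_tangent[OF conv _ _ _ d0]) auto
  then show ?thesis
    by (simp add: G_def)
qed

text \<open>After division by \<open>1 - l * x / 3\<close>, monotonicity replaces \<open>x\<close>
  there by its bound \<open>b\<close>. The coefficient of \<open>x^2\<close> is then constant, so
  that expectations involve only mean and variance.\<close>

lemma exp_le_sub_gamma:
  fixes l x b :: real
  assumes "l > 0" "l * b < 3" "x \<le> b"
  shows "exp (l * x) \<le> 1 + l * x + l\<^sup>2 / (2 * (1 - l * b / 3)) * x\<^sup>2"
proof -
  have lx: "l * x \<le> l * b"
    using assms by simp
  then have lx3: "l * x < 3"
    using assms(2) by linarith
  have "(1 - l * x / 3) * (exp (l * x) - 1 - l * x) \<le> (l * x)\<^sup>2 / 2"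
    by (rule exp_le_Bernstein)
  then have "exp (l * x) - 1 - l * x \<le> (l * x)\<^sup>2 / 2 / (1 - l * x / 3)"
    using lx3 by (subst pos_le_divide_eq) (auto simp: mult.commute)
  also have "\<dots> \<le> (l * x)\<^sup>2 / 2 / (1 - l * b / 3)"
    using lx lx3 assms(2) by (intro divide_left_mono) auto
  finally show ?thesis
    by (simp add: power_mult_distrib)
qed

text \<open>The difference of the two sides vanishes at 0 and increases. This is the source of the
  sub-Gaussian lower tail of nonnegative variables.\<close>

lemma exp_minus_le_quadratic:
  fixes y :: real
  assumes "0 \<le> y"
  shows "exp (-y) \<le> 1 - y + y\<^sup>2 / 2"
proof -
  have "(\<lambda>y::real. 1 - y + y\<^sup>2 / 2 - exp (-y)) 0 \<le> (\<lambda>y. 1 - y + y\<^sup>2 / 2 - exp (-y)) y"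
  proof (rule DERIV_nonneg_imp_nondecreasing[OF assms])
    fix t :: real
    have "((\<lambda>y. 1 - y + y\<^sup>2 / 2 - exp (-y)) has_real_derivative (-1 + t + exp (-t))) (at t)"
      by (rule derivative_eq_intros refl | simp)+
    moreover have "0 \<le> -1 + t + exp (-t)"
      using exp_ge_add_one_self[of "-t"] by simp
    ultimately show "\<exists>z. ((\<lambda>y. 1 - y + y\<^sup>2 / 2 - exp (-y)) has_real_derivative z) (at t) \<and> 0 \<le> z"
      by blast
  qed
  then show ?thesis by simp
qed

context prob_space
begin

lemma expectation_exp_sum_le:
  fixes X :: "'i \<Rightarrow> 'a \<Rightarrow> real"
  assumes fin: "finite I" and indep: "indep_vars (\<lambda>_. borel) X I"
    and int: "\<And>i. i \<in> I \<Longrightarrow> integrable M (\<lambda>\<omega>. exp (X i \<omega>))"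
    and mgf: "\<And>i. i \<in> I \<Longrightarrow> expectation (\<lambda>\<omega>. exp (X i \<omega>)) \<le> exp u"
  shows "integrable M (\<lambda>\<omega>. exp (\<Sum>i\<in>I. X i \<omega>))"
    and "expectation (\<lambda>\<omega>. exp (\<Sum>i\<in>I. X i \<omega>)) \<le> exp (real (card I) * u)"
proof -
  have ind: "indep_vars (\<lambda>_. borel) (\<lambda>i \<omega>. exp (X i \<omega>)) I"
    by (rule indep_vars_compose2[OF indep]) auto
  note eq = exp_sum[OF fin]
  show "integrable M (\<lambda>\<omega>. exp (\<Sum>i\<in>I. X i \<omega>))"
    unfolding eq by (rule indep_vars_integrable[OF fin ind int])
  have "expectation (\<lambda>\<omega>. exp (\<Sum>i\<in>I. X i \<omega>)) = (\<Prod>i\<in>I. expectation (\<lambda>\<omega>. exp (X i \<omega>)))"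
    unfolding eq by (rule indep_vars_lebesgue_integral[OF fin ind int])
  also have "\<dots> \<le> (\<Prod>i\<in>I. exp u)"
    by (intro prod_mono conjI mgf integral_nonneg_AE) auto
  also have "\<dots> = exp (real (card I) * u)"
    by (simp add: exp_of_nat_mult)
  finally show "expectation (\<lambda>\<omega>. exp (\<Sum>i\<in>I. X i \<omega>)) \<le> exp (real (card I) * u)" .
qed

lemma Chernoff_bound:
  assumes "integrable M (\<lambda>\<omega>. exp (X \<omega>))" "expectation (\<lambda>\<omega>. exp (X \<omega>)) \<le> exp u"
    and [measurable]: "random_variable borel X"
  shows "prob {\<omega>\<in>space M. X \<omega> \<ge> t} \<le> exp (u - t)"
proof -
  have "prob {\<omega>\<in>space M. X \<omega> \<ge> t} = prob {\<omega>\<in>space M. exp t \<le> exp (X \<omega>)}"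
    by simp
  also have "\<dots> \<le> expectation (\<lambda>\<omega>. exp (X \<omega>)) / exp t"
    by (rule integral_Markov_inequality_measure[OF assms(1), where A="{}"]) auto
  also have "\<dots> \<le> exp u / exp t"
    using assms by (intro divide_right_mono) auto
  finally show ?thesis by (simp add: exp_diff)
qed

lemma integrable_AE_bounded:
  fixes X :: "'a \<Rightarrow> real"
  assumes "random_variable borel X" "AE \<omega> in M. \<bar>X \<omega>\<bar> \<le> B"
  shows "integrable M X"
  using assms by (intro integrable_const_bound[where B=B]) auto

text \<open>Chernoff's method, with the threshold solved for the confidence level \<open>c\<close>:
  the square root is the Gaussian part, \<open>b * c / 3\<close> the correction for
  boundedness.\<close>

lemma Bernstein_upper_tail:
  fixes X :: "'i \<Rightarrow> 'a \<Rightarrow> real"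
  assumes fin: "finite I" "I \<noteq> {}" and indep: "indep_vars (\<lambda>_. borel) X I"
    and bnd: "\<And>i. i \<in> I \<Longrightarrow> AE \<omega> in M. \<bar>X i \<omega>\<bar> \<le> b"
    and mean: "\<And>i. i \<in> I \<Longrightarrow> expectation (X i) = 0"
    and var: "\<And>i. i \<in> I \<Longrightarrow> expectation (\<lambda>\<omega>. (X i \<omega>)\<^sup>2) = v"
    and c: "c > 0" and b: "b > 0"
  shows "prob {\<omega>\<in>space M. (\<Sum>i\<in>I. X i \<omega>) \<ge> sqrt (2 * c * real (card I) * v) + b * c / 3} \<le> exp (-c)"
proof -
  define k where "k = real (card I)"
  have k: "k > 0"
    using fin by (simp add: k_def card_gt_0_iff)
  have rv[measurable]: "random_variable borel (X i)" if "i \<in> I" for i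
    using indep that by (auto simp: indep_vars_def)
  have int: "integrable M (X i)" and int2: "integrable M (\<lambda>\<omega>. (X i \<omega>)\<^sup>2)" if "i \<in> I" for i
  proof -
    show "integrable M (X i)"
      by (rule integrable_AE_bounded[OF rv[OF that] bnd[OF that]])
    show "integrable M (\<lambda>\<omega>. (X i \<omega>)\<^sup>2)"
    proof (rule integrable_AE_bounded)
      show "AE \<omega> in M. \<bar>(X i \<omega>)\<^sup>2\<bar> \<le> b\<^sup>2"
        using bnd[OF that]
      proof eventually_elim
        case (elim \<omega>)
        then show ?case using power_mono[of "\<bar>X i \<omega>\<bar>" b 2] by simp
      qed
    qed (use that in measurable)
  qed
  have v0: "v \<ge> 0"
  proof -
    obtain i where i: "i \<in> I"
      using fin by blast
    have "0 \<le> expectation (\<lambda>\<omega>. (X i \<omega>)\<^sup>2)"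
      by (rule integral_nonneg_AE) simp
    then show ?thesis
      by (simp add: var[OF i])
  qed
  show ?thesis
  proof (cases "v = 0")
    \<comment> \<open>The Chernoff parameter divides by \<open>v\<close>. With zero variance all
      variables vanish almost surely, while the threshold \<open>b * c / 3\<close> is
      positive.\<close>
    case True
    have "AE \<omega> in M. \<forall>i\<in>I. X i \<omega> = 0"
    proof (rule AE_finite_allI[OF fin(1)])
      fix i assume i: "i \<in> I"
      have "AE \<omega> in M. (X i \<omega>)\<^sup>2 = 0"
        using integral_nonneg_eq_0_iff_AE[OF int2[OF i]] var[OF i] True by simp
      then show "AE \<omega> in M. X i \<omega> = 0" by simp
    qed
    then have "AE \<omega> in M. \<not> (\<Sum>i\<in>I. X i \<omega>) \<ge> sqrt (2 * c * real (card I) * v) + b * c / 3"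
      by eventually_elim (use True b c in \<open>simp add: not_le\<close>)
    then have "prob {\<omega>\<in>space M. (\<Sum>i\<in>I. X i \<omega>) \<ge> sqrt (2 * c * real (card I) * v) + b * c / 3} = 0"
      by (subst prob_eq_0) auto
    then show ?thesis by simp
  next
    case False
    with v0 have v: "v > 0" by simp
    text \<open>The parameter \<open>l\<close> below is chosen so that the Chernoff exponent is exactly \<open>-c\<close>.\<close>
    define u where "u = sqrt (2 * c / (k * v))"
    have u: "u > 0" and u2: "u\<^sup>2 * k * v = 2 * c"
      using c k v by (auto simp: u_def)
    define l where "l = u / (1 + b * u / 3)"
    have den: "1 + b * u / 3 > 0"
      using u b by (simp add: add_pos_pos)
    have l: "l > 0" using u den by (simp add: l_def)
    have lb: "l * b < 3" and lb': "1 - l * b / 3 = 1 / (1 + b * u / 3)"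
      using den by (auto simp: l_def field_simps)
    define q where "q = l\<^sup>2 / (2 * (1 - l * b / 3))"
    have int_exp: "integrable M (\<lambda>\<omega>. exp (l * X i \<omega>))" if "i \<in> I" for i
    proof (rule integrable_AE_bounded)
      show "AE \<omega> in M. \<bar>exp (l * X i \<omega>)\<bar> \<le> exp (l * b)"
        using bnd[OF that] by eventually_elim (use l in auto)
    qed (use that in measurable)
    have mgf: "expectation (\<lambda>\<omega>. exp (l * X i \<omega>)) \<le> exp (q * v)" if "i \<in> I" for i
    proof -
      have "expectation (\<lambda>\<omega>. exp (l * X i \<omega>)) \<le> expectation (\<lambda>\<omega>. 1 + l * X i \<omega> + q * (X i \<omega>)\<^sup>2)"
      proof (rule integral_mono_AE[OF int_exp[OF that]])
        show "AE \<omega> in M. exp (l * X i \<omega>) \<le> 1 + l * X i \<omega> + q * (X i \<omega>)\<^sup>2"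
          using bnd[OF that] unfolding q_def
          by eventually_elim (use exp_le_sub_gamma[OF l lb] in auto)
      qed (use int[OF that] int2[OF that] in auto)
      also have "\<dots> = 1 + q * v"
        using int[OF that] int2[OF that] mean[OF that] var[OF that] by (simp add: prob_space)
      also have "\<dots> \<le> exp (q * v)"
        by (rule exp_ge_add_one_self)
      finally show ?thesis .
    qed
    have ind: "indep_vars (\<lambda>_. borel) (\<lambda>i \<omega>. l * X i \<omega>) I"
      by (rule indep_vars_compose2[OF indep]) auto
    define t where "t = sqrt (2 * c * k * v) + b * c / 3"
    have "prob {\<omega>\<in>space M. (\<Sum>i\<in>I. X i \<omega>) \<ge> t} = prob {\<omega>\<in>space M. (\<Sum>i\<in>I. l * X i \<omega>) \<ge> l * t}"
      using l by (simp flip: sum_distrib_left)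
    also have "\<dots> \<le> exp (k * (q * v) - l * t)"
      unfolding k_def
      by (rule Chernoff_bound[OF expectation_exp_sum_le[OF fin(1) ind int_exp mgf]]) auto
    \<comment> \<open>\<open>u\<close> is the optimal parameter for a Gaussian of variance
      \<open>k * v\<close>. Both terms acquire the denominator \<open>1 + b * u / 3\<close>, and
      \<open>u^2 * k * v = 2 * c\<close> turns the numerator into
      \<open>c - 2 * c * (1 + b * u / 6)\<close>.\<close>
    also have "k * (q * v) - l * t = - c"
    proof -
      have "sqrt (2 * c * k * v) = u * k * v"
      proof (rule real_sqrt_unique)
        show "(u * k * v)\<^sup>2 = 2 * c * k * v"
          using u2 by (simp add: power_mult_distrib power2_eq_square algebra_simps)
      qed (use u k v in auto)
      then have "t = u * k * v * (1 + b * u / 6)"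
        using u2 by (simp add: t_def power2_eq_square algebra_simps)
      moreover have "q = u\<^sup>2 / (1 + b * u / 3) / 2"
        using den unfolding q_def lb' by (simp add: l_def power2_eq_square)
      ultimately have "k * (q * v) - l * t
          = (u\<^sup>2 * k * v / 2 - u\<^sup>2 * k * v * (1 + b * u / 6)) / (1 + b * u / 3)"
        by (simp add: l_def diff_divide_distrib power2_eq_square mult_ac)
      also have "\<dots> = - c * (1 + b * u / 3) / (1 + b * u / 3)"
        unfolding u2 by (simp add: algebra_simps)
      finally show ?thesis using den by simp
    qed
    finally show ?thesis by (simp add: t_def k_def)
  qed
qed

end

section \<open>Concentration of the sample variance\<close>

text \<open>Double counting. Composing with a permutation that sends \<open>(a, b)\<close> to
  \<open>(c, d)\<close> shows that the sum over \<open>p\<close> is the same for all ordered pairs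
  of distinct elements; after summing over these pairs and swapping the sums, each \<open>p\<close>
  merely permutes the pairs.\<close>

lemma sum_permutes_pair:
  fixes g :: "'a \<Rightarrow> 'a \<Rightarrow> real"
  assumes S: "finite S" and ab: "a \<in> S" "b \<in> S" "a \<noteq> b"
  shows "real (card S) * (real (card S) - 1) * (\<Sum>p | p permutes S. g (p a) (p b))
       = fact (card S) * (\<Sum>(c, d)\<in>Sigma S (\<lambda>c. S - {c}). g c d)"
proof -
  let ?O = "Sigma S (\<lambda>c. S - {c})"
  let ?P = "{p. p permutes S}"
  have indep: "(\<Sum>p\<in>?P. g (p c) (p d)) = (\<Sum>p\<in>?P. g (p a) (p b))" if "(c, d) \<in> ?O" for c d
  proof -
    define q1 where "q1 = Transposition.transpose a c"
    \<comment> \<open>The first transposition sends \<open>a\<close> to \<open>c\<close>, the second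
      corrects the image of \<open>b\<close>. It leaves \<open>c\<close> in place because
      \<open>c\<close> differs from both \<open>q1 b\<close> and \<open>d\<close>.\<close>
    define q where "q = Transposition.transpose (q1 b) d \<circ> q1"
    have q1: "q1 permutes S"
      unfolding q1_def using that ab by (intro permutes_swap_id) auto
    have "q1 b \<noteq> q1 a"
      using ab permutes_inj[OF q1] by (auto dest: injD)
    then have b': "q1 b \<noteq> c"
      by (simp add: q1_def)
    have q: "q permutes S"
      unfolding q_def using that ab q1
      by (intro permutes_compose[OF q1] permutes_swap_id) (auto simp: permutes_in_image)
    have "q a = c" "q b = d"
      using that b' by (auto simp: q_def q1_def Transposition.transpose_def)
    then show ?thesis
      using sum_permutations_compose_right[OF q, of "\<lambda>p. g (p a) (p b)"] by simp
  qed
  have reindex: "(\<Sum>(c, d)\<in>?O. g (p c) (p d)) = (\<Sum>(c, d)\<in>?O. g c d)" if p: "p permutes S" for p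
  proof (rule sum.reindex_bij_witness[of _ "\<lambda>(c, d). (inv p c, inv p d)" "\<lambda>(c, d). (p c, p d)"])
    have inj: "p x = p y \<longleftrightarrow> x = y" "inv p x = inv p y \<longleftrightarrow> x = y" for x y
      using permutes_inj[OF p] permutes_inj[OF permutes_inv[OF p]] by (auto dest: injD)
    fix z :: "'a \<times> 'a" assume "z \<in> ?O"
    then show "(case case z of (c, d) \<Rightarrow> (p c, p d) of (c, d) \<Rightarrow> (inv p c, inv p d)) = z"
      and "(case z of (c, d) \<Rightarrow> (p c, p d)) \<in> ?O"
      and "(case case z of (c, d) \<Rightarrow> (inv p c, inv p d) of (c, d) \<Rightarrow> (p c, p d)) = z"
      and "(case z of (c, d) \<Rightarrow> (inv p c, inv p d)) \<in> ?O"
      and "(case case z of (c, d) \<Rightarrow> (p c, p d) of (c, d) \<Rightarrow> g c d) = (case z of (c, d) \<Rightarrow> g (p c) (p d))"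
      using p permutes_inv[OF p] by (auto simp: permutes_inverses permutes_in_image inj)
  qed
  have "real (card ?O) = (\<Sum>c\<in>S. real (card S) - 1)"
    using S card_Diff_singleton[of _ S] card_gt_0_iff[of S]
    by (subst card_SigmaI) (auto intro!: sum.cong simp: of_nat_diff Suc_le_eq)
  then have "real (card S) * (real (card S) - 1) * (\<Sum>p\<in>?P. g (p a) (p b))
      = (\<Sum>(c, d)\<in>?O. \<Sum>p\<in>?P. g (p a) (p b))"
    by (simp add: split_beta)
  also have "\<dots> = (\<Sum>(c, d)\<in>?O. \<Sum>p\<in>?P. g (p c) (p d))"
  proof (intro sum.cong refl)
    fix z assume "z \<in> ?O"
    then show "(case z of (c, d) \<Rightarrow> \<Sum>p\<in>?P. g (p a) (p b)) = (case z of (c, d) \<Rightarrow> \<Sum>p\<in>?P. g (p c) (p d))"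
      using indep[of "fst z" "snd z"] by (simp add: split_beta)
  qed
  also have "\<dots> = (\<Sum>p\<in>?P. \<Sum>(c, d)\<in>?O. g (p c) (p d))"
    unfolding split_beta by (rule sum.swap)
  also have "\<dots> = (\<Sum>p\<in>?P. \<Sum>(c, d)\<in>?O. g c d)"
    by (intro sum.cong refl reindex) simp
  also have "\<dots> = fact (card S) * (\<Sum>(c, d)\<in>?O. g c d)"
    by (simp add: card_permutations[OF refl S])
  finally show ?thesis .
qed

section \<open>Algebra of squared deviations\<close>

lemma sum_deviations_eq:
  fixes y :: "'i \<Rightarrow> real"
  assumes "finite I" "I \<noteq> {}"
  shows "(\<Sum>i\<in>I. (y i - (\<Sum>j\<in>I. y j) / real (card I))\<^sup>2) = (\<Sum>i\<in>I. (y i)\<^sup>2) - (\<Sum>i\<in>I. y i)\<^sup>2 / real (card I)"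
proof -
  define k A where "k = real (card I)" and "A = (\<Sum>j\<in>I. y j)"
  have k: "k > 0"
    using assms by (simp add: k_def card_gt_0_iff)
  have "(\<Sum>i\<in>I. (y i - A / k)\<^sup>2) = (\<Sum>i\<in>I. (y i)\<^sup>2) - 2 * (A / k) * A + k * (A / k)\<^sup>2"
    unfolding power2_diff sum.distrib sum_subtractf
    by (simp add: A_def k_def sum_distrib_left[symmetric] sum_distrib_right[symmetric] sum_divide_distrib[symmetric] mult_ac)
  also have "\<dots> = (\<Sum>i\<in>I. (y i)\<^sup>2) - A\<^sup>2 / k"
    using k by (simp add: field_simps power2_eq_square)
  finally show ?thesis by (simp add: k_def A_def)
qed

lemma sum_deviations_le:
  fixes y :: "'i \<Rightarrow> real"
  assumes "finite I" "I \<noteq> {}"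
  shows "(\<Sum>i\<in>I. (y i - (\<Sum>j\<in>I. y j) / real (card I))\<^sup>2) \<le> (\<Sum>i\<in>I. (y i)\<^sup>2)"
  unfolding sum_deviations_eq[OF assms] by simp

lemma sum_deviations_eq_pairs:
  fixes y :: "'i \<Rightarrow> real"
  assumes "finite I" "I \<noteq> {}"
  shows "2 * real (card I) * (\<Sum>i\<in>I. (y i - (\<Sum>j\<in>I. y j) / real (card I))\<^sup>2) = (\<Sum>i\<in>I. \<Sum>j\<in>I. (y i - y j)\<^sup>2)"
proof -
  define k A Q where "k = real (card I)" and "A = (\<Sum>j\<in>I. y j)" and "Q = (\<Sum>j\<in>I. (y j)\<^sup>2)"
  have k: "k > 0"
    using assms by (simp add: k_def card_gt_0_iff)
  have "(\<Sum>i\<in>I. \<Sum>j\<in>I. (y i - y j)\<^sup>2) = 2 * k * Q - 2 * A\<^sup>2"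
    by (simp add: power2_diff sum.distrib sum_subtractf sum_distrib_left[symmetric] sum_distrib_right[symmetric]
        Q_def[symmetric] A_def[symmetric] k_def[symmetric])
       (simp add: power2_eq_square)
  also have "\<dots> = 2 * k * (Q - A\<^sup>2 / k)"
    using k by (simp add: field_simps)
  finally show ?thesis
    unfolding sum_deviations_eq[OF assms] by (simp add: k_def A_def Q_def)
qed

section \<open>Independent bounded samples with common mean \<open>m\<close> and variance
  \<open>v\<close>\<close>

locale bounded_sample = prob_space M for M :: "'a measure" +
  fixes Y :: "nat \<Rightarrow> 'a \<Rightarrow> real" and n :: nat and B m v :: real
  assumes n2: "n \<ge> 2" and B: "B > 0"
    and indep: "indep_vars (\<lambda>_. borel) Y {..<n}"
    and bnd: "\<And>i. i < n \<Longrightarrow> AE \<omega> in M. \<bar>Y i \<omega>\<bar> \<le> B"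
    and mean: "\<And>i. i < n \<Longrightarrow> expectation (Y i) = m"
    and second_moment: "\<And>i. i < n \<Longrightarrow> expectation (\<lambda>\<omega>. (Y i \<omega>)\<^sup>2) = m\<^sup>2 + v"
begin

definition avg :: "'a \<Rightarrow> real" where
  "avg \<omega> = (\<Sum>i<n. Y i \<omega>) / real n"

definition svr :: "'a \<Rightarrow> real" where
  "svr \<omega> = (\<Sum>i<n. (Y i \<omega> - avg \<omega>)\<^sup>2) / (real n - 1)"

lemma rv [measurable]: "i < n \<Longrightarrow> random_variable borel (Y i)"
  using indep by (auto simp: indep_vars_def)

lemma avg_measurable [measurable]: "random_variable borel avg"
  unfolding avg_def by measurable

lemma svr_measurable [measurable]: "random_variable borel svr"
  unfolding svr_def by measurable

lemma svr_nonneg: "svr \<omega> \<ge> 0"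
  unfolding svr_def using n2 by (intro divide_nonneg_nonneg sum_nonneg) auto

lemma integrable_Y: "i < n \<Longrightarrow> integrable M (Y i)"
  by (rule integrable_AE_bounded[OF rv bnd])

lemma integrable_Y2: "i < n \<Longrightarrow> integrable M (\<lambda>\<omega>. (Y i \<omega>)\<^sup>2)"
proof (rule integrable_AE_bounded)
  assume i: "i < n"
  show "AE \<omega> in M. \<bar>(Y i \<omega>)\<^sup>2\<bar> \<le> B\<^sup>2"
    using bnd[OF i]
  proof eventually_elim
    case (elim \<omega>)
    then show ?case using power_mono[of "\<bar>Y i \<omega>\<bar>" B 2] by simp
  qed
  show "random_variable borel (\<lambda>\<omega>. (Y i \<omega>)\<^sup>2)"
    using i by measurable
qed

lemma v_nonneg: "v \<ge> 0"
proof -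
  have "0 < n" using n2 by simp
  note int = integrable_Y[OF this] integrable_Y2[OF this]
  have "0 \<le> expectation (\<lambda>\<omega>. (Y 0 \<omega> - m)\<^sup>2)"
    by (rule integral_nonneg_AE) simp
  also have "\<dots> = v"
    using int mean[OF \<open>0 < n\<close>] second_moment[OF \<open>0 < n\<close>]
    by (simp add: power2_diff prob_space) (simp add: power2_eq_square)
  finally show ?thesis .
qed

text \<open>By independence the cross term has expectation \<open>m * m\<close>, which cancels the
  \<open>m^2\<close> in the second moments.\<close>

lemma pair_expectation:
  assumes "a < n" "b < n" "a \<noteq> b"
  shows "expectation (\<lambda>\<omega>. (Y a \<omega> - Y b \<omega>)\<^sup>2 / 2) = v" and "integrable M (\<lambda>\<omega>. (Y a \<omega> - Y b \<omega>)\<^sup>2 / 2)"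
proof -
  have sub: "indep_vars (\<lambda>_. borel) Y {a, b}"
    by (rule indep_vars_subset[OF indep]) (use assms in auto)
  note int = integrable_Y[OF assms(1)] integrable_Y[OF assms(2)] integrable_Y2[OF assms(1)] integrable_Y2[OF assms(2)]
  have int_ab: "integrable M (\<lambda>\<omega>. \<Prod>i\<in>{a, b}. Y i \<omega>)"
    by (rule indep_vars_integrable[OF _ sub]) (use int in auto)
  have "expectation (\<lambda>\<omega>. \<Prod>i\<in>{a, b}. Y i \<omega>) = (\<Prod>i\<in>{a, b}. expectation (Y i))"
    by (rule indep_vars_lebesgue_integral[OF _ sub]) (use int in auto)
  then have ab: "expectation (\<lambda>\<omega>. Y a \<omega> * Y b \<omega>) = m * m"
    using assms mean by simp
  have int_ab': "integrable M (\<lambda>\<omega>. Y a \<omega> * Y b \<omega>)"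
    using int_ab assms by simp
  show "expectation (\<lambda>\<omega>. (Y a \<omega> - Y b \<omega>)\<^sup>2 / 2) = v"
    using int int_ab' ab second_moment assms by (simp add: power2_diff mult.assoc) (simp add: power2_eq_square)
  show "integrable M (\<lambda>\<omega>. (Y a \<omega> - Y b \<omega>)\<^sup>2 / 2)"
    using int int_ab' by (simp add: power2_diff mult.assoc)
qed

text \<open>The half squared difference \<open>W\<close> lies between 0 and \<open>2 * B^2\<close>,
  so in the quadratic bound for \<open>exp (- l W)\<close> the square is at most
  \<open>2 * B^2 * W\<close>. The bound is thus linear in \<open>W\<close> and only its mean
  \<open>v\<close> matters.\<close>

lemma pair_mgf:
  assumes ab: "a < n" "b < n" "a \<noteq> b" and l: "l \<ge> 0"
  shows "expectation (\<lambda>\<omega>. exp (- (l * ((Y a \<omega> - Y b \<omega>)\<^sup>2 / 2)))) \<le> exp (l\<^sup>2 * B\<^sup>2 * v - l * v)"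
    and "integrable M (\<lambda>\<omega>. exp (- (l * ((Y a \<omega> - Y b \<omega>)\<^sup>2 / 2))))"
proof -
  define W where "W = (\<lambda>\<omega>. (Y a \<omega> - Y b \<omega>)\<^sup>2 / 2)"
  have W[measurable]: "random_variable borel W"
    unfolding W_def using ab by measurable
  have int: "integrable M W" and EW: "expectation W = v"
    unfolding W_def using pair_expectation[OF ab] by auto
  have W_eq: "(Y a \<omega> - Y b \<omega>)\<^sup>2 / 2 = W \<omega>" for \<omega>
    by (simp add: W_def)
  show int_exp: "integrable M (\<lambda>\<omega>. exp (- (l * ((Y a \<omega> - Y b \<omega>)\<^sup>2 / 2))))"
    unfolding W_eq
  proof (rule integrable_AE_bounded[where B=1])
    show "random_variable borel (\<lambda>\<omega>. exp (- (l * W \<omega>)))"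
      by measurable
  qed (use l in \<open>auto simp: W_def\<close>)
  have "AE \<omega> in M. exp (- (l * W \<omega>)) \<le> 1 - l * W \<omega> + l\<^sup>2 * B\<^sup>2 * W \<omega>"
    using bnd[OF ab(1)] bnd[OF ab(2)]
  proof eventually_elim
    case (elim \<omega>)
    have "\<bar>Y a \<omega> - Y b \<omega>\<bar> \<le> 2 * B"
      using elim by linarith
    then have "(Y a \<omega> - Y b \<omega>)\<^sup>2 \<le> (2 * B)\<^sup>2"
      using power_mono[of "\<bar>Y a \<omega> - Y b \<omega>\<bar>" "2 * B" 2] by simp
    then have W2: "W \<omega> \<le> 2 * B\<^sup>2" and W0: "W \<omega> \<ge> 0"
      by (auto simp: W_def power_mult_distrib)
    have "exp (- (l * W \<omega>)) \<le> 1 - l * W \<omega> + (l * W \<omega>)\<^sup>2 / 2"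
      using W0 l by (intro exp_minus_le_quadratic) auto
    also have "(l * W \<omega>)\<^sup>2 = l\<^sup>2 * W \<omega> * W \<omega>"
      by (simp add: power2_eq_square)
    also have "l\<^sup>2 * W \<omega> * W \<omega> \<le> l\<^sup>2 * W \<omega> * (2 * B\<^sup>2)"
      using W0 W2 by (intro mult_left_mono) auto
    finally show ?case by (simp add: mult_ac)
  qed
  then have "expectation (\<lambda>\<omega>. exp (- (l * W \<omega>))) \<le> expectation (\<lambda>\<omega>. 1 - l * W \<omega> + l\<^sup>2 * B\<^sup>2 * W \<omega>)"
    using int int_exp unfolding W_eq by (intro integral_mono_AE) auto
  also have "\<dots> = 1 + (l\<^sup>2 * B\<^sup>2 * v - l * v)"
    using int by (simp add: EW prob_space)
  also have "\<dots> \<le> exp (l\<^sup>2 * B\<^sup>2 * v - l * v)"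
    by (rule exp_ge_add_one_self)
  finally show "expectation (\<lambda>\<omega>. exp (- (l * ((Y a \<omega> - Y b \<omega>)\<^sup>2 / 2)))) \<le> exp (l\<^sup>2 * B\<^sup>2 * v - l * v)"
    by (simp add: W_def)
qed

text \<open>Neighbouring positions of the permuted sample are paired; for odd \<open>n\<close> the
  last position stays unpaired.\<close>

definition pairs :: "(nat \<Rightarrow> nat) \<Rightarrow> 'a \<Rightarrow> real" where
  "pairs p \<omega> = (\<Sum>j<n div 2. (Y (p (2 * j)) \<omega> - Y (p (2 * j + 1)) \<omega>)\<^sup>2 / 2)"

lemma pairs_mgf:
  assumes p: "p permutes {..<n}" and l: "l \<ge> 0"
  shows "integrable M (\<lambda>\<omega>. exp (- (l * pairs p \<omega>)))"
    and "expectation (\<lambda>\<omega>. exp (- (l * pairs p \<omega>))) \<le> exp (real (n div 2) * (l\<^sup>2 * B\<^sup>2 * v - l * v))"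
proof -
  define J where "J = (\<lambda>j::nat. {p (2 * j), p (2 * j + 1)})"
  have lt: "p (2 * j) < n" "p (2 * j + 1) < n" if "j < n div 2" for j
    using that permutes_in_image[OF p, of "2 * j"] permutes_in_image[OF p, of "2 * j + 1"] by auto
  have inj: "p x = p y \<longleftrightarrow> x = y" for x y
    using permutes_inj[OF p] by (auto dest: injD)
  \<comment> \<open>Injectivity of \<open>p\<close> makes the index blocks \<open>J j\<close>
    disjoint, hence the pair terms independent.\<close>
  have "indep_vars (\<lambda>j. PiM (J j) (\<lambda>_. borel)) (\<lambda>j \<omega>. restrict (\<lambda>i. Y i \<omega>) (J j)) {..<n div 2}"
  proof (rule indep_vars_restrict[OF indep])
    show "J j \<subseteq> {..<n}" if "j \<in> {..<n div 2}" for j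
      using lt[of j] that by (auto simp: J_def)
    show "disjoint_family_on J {..<n div 2}"
      unfolding disjoint_family_on_def J_def by (auto simp: inj)
  qed
  then have "indep_vars (\<lambda>_. borel) (\<lambda>j \<omega>. (\<lambda>z. - (l * ((z (p (2 * j)) - z (p (2 * j + 1)))\<^sup>2 / 2)))
      (restrict (\<lambda>i. Y i \<omega>) (J j))) {..<n div 2}"
    by (rule indep_vars_compose2) (auto simp: J_def)
  then have ind: "indep_vars (\<lambda>_. borel) (\<lambda>j \<omega>. - (l * ((Y (p (2 * j)) \<omega> - Y (p (2 * j + 1)) \<omega>)\<^sup>2 / 2))) {..<n div 2}"
    by (simp add: J_def)
  have eq: "- (l * pairs p \<omega>) = (\<Sum>j<n div 2. - (l * ((Y (p (2 * j)) \<omega> - Y (p (2 * j + 1)) \<omega>)\<^sup>2 / 2)))" for \<omega>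
    by (simp add: pairs_def sum_distrib_left sum_negf)
  note mgf = expectation_exp_sum_le[OF finite_lessThan ind, of "l\<^sup>2 * B\<^sup>2 * v - l * v"]
  show "integrable M (\<lambda>\<omega>. exp (- (l * pairs p \<omega>)))"
    unfolding eq using lt by (intro mgf pair_mgf l) (auto simp: inj)
  show "expectation (\<lambda>\<omega>. exp (- (l * pairs p \<omega>))) \<le> exp (real (n div 2) * (l\<^sup>2 * B\<^sup>2 * v - l * v))"
  proof -
    have "expectation (\<lambda>\<omega>. exp (- (l * pairs p \<omega>)))
        \<le> exp (real (card {..<n div 2}) * (l\<^sup>2 * B\<^sup>2 * v - l * v))"
      unfolding eq using lt by (intro mgf pair_mgf l) (auto simp: inj)
    then show ?thesis by simp
  qed
qed

text \<open>Over all permutations, each of the \<open>n div 2\<close> position pairs averages to the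
  mean of \<open>g\<close> over ordered pairs of distinct indices, and that mean is the sample
  variance.\<close>

lemma svr_eq_average_pairs:
  "real (n div 2) * svr \<omega> = (\<Sum>p | p permutes {..<n}. pairs p \<omega> / fact n)"
proof -
  define g where "g = (\<lambda>a b. (Y a \<omega> - Y b \<omega>)\<^sup>2 / 2)"
  let ?P = "{p. p permutes {..<n}}"
  have n1: "real n * (real n - 1) > 0" using n2 by simp
  have "(\<Sum>(c, d)\<in>Sigma {..<n} (\<lambda>c. {..<n} - {c}). g c d) = (\<Sum>c<n. \<Sum>d\<in>{..<n} - {c}. g c d)"
    by (subst sum.Sigma) auto
  \<comment> \<open>The diagonal may be added because \<open>g c c = 0\<close>.\<close>
  also have "\<dots> = (\<Sum>c<n. \<Sum>d<n. g c d)"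
    by (intro sum.cong refl sum.mono_neutral_left) (auto simp: g_def)
  also have "\<dots> = real n * (\<Sum>i<n. (Y i \<omega> - avg \<omega>)\<^sup>2)"
    using sum_deviations_eq_pairs[of "{..<n}" "\<lambda>i. Y i \<omega>"] n2
    by (simp add: g_def avg_def sum_divide_distrib[symmetric] lessThan_empty_iff)
  also have "\<dots> = real n * (real n - 1) * svr \<omega>"
    using n2 by (simp add: svr_def)
  finally have O: "(\<Sum>(c, d)\<in>Sigma {..<n} (\<lambda>c. {..<n} - {c}). g c d) = real n * (real n - 1) * svr \<omega>" .
  have *: "(\<Sum>p\<in>?P. g (p (2 * j)) (p (2 * j + 1))) = fact n * svr \<omega>" if "j < n div 2" for j
    using sum_permutes_pair[of "{..<n}" "2 * j" "2 * j + 1" g] that n1 unfolding O by simp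
  have "(\<Sum>p\<in>?P. pairs p \<omega>) = (\<Sum>j<n div 2. \<Sum>p\<in>?P. g (p (2 * j)) (p (2 * j + 1)))"
    unfolding pairs_def g_def by (rule sum.swap)
  also have "\<dots> = real (n div 2) * (fact n * svr \<omega>)"
    using * by simp
  finally show ?thesis
    by (simp add: sum_divide_distrib[symmetric])
qed

text \<open>Hoeffding's device for U-statistics: terms from different permutations are dependent,
  but Jensen for \<open>exp\<close> with weights \<open>1 / fact n\<close> reduces the average to
  single permutations, within which the terms are independent.\<close>

lemma svr_mgf:
  assumes l: "l \<ge> 0"
  shows "integrable M (\<lambda>\<omega>. exp (- (l * (real (n div 2) * svr \<omega>))))"
    and "expectation (\<lambda>\<omega>. exp (- (l * (real (n div 2) * svr \<omega>)))) \<le> exp (real (n div 2) * (l\<^sup>2 * B\<^sup>2 * v - l * v))"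
proof -
  let ?P = "{p. p permutes {..<n}}"
  have finP: "finite ?P" and cardP: "card ?P = fact n"
    using finite_permutations[of "{..<n}"] card_permutations[of "{..<n}" n] by auto
  have one: "(\<Sum>p\<in>?P. 1 / fact n :: real) = 1"
    by (simp add: cardP)
  show int: "integrable M (\<lambda>\<omega>. exp (- (l * (real (n div 2) * svr \<omega>))))"
    by (rule integrable_AE_bounded[where B=1]) (use l svr_nonneg in auto)
  have le: "exp (- (l * (real (n div 2) * svr \<omega>))) \<le> (\<Sum>p\<in>?P. 1 / fact n * exp (- (l * pairs p \<omega>)))" for \<omega>
  proof -
    have "exp (\<Sum>p\<in>?P. (1 / fact n) *\<^sub>R (- (l * pairs p \<omega>))) \<le> (\<Sum>p\<in>?P. 1 / fact n * exp (- (l * pairs p \<omega>)))"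
      by (rule convex_on_sum[OF finP _ exp_convex one]) (auto intro: permutes_id)
    also have "(\<Sum>p\<in>?P. (1 / fact n) *\<^sub>R (- (l * pairs p \<omega>))) = - (l * (real (n div 2) * svr \<omega>))"
      unfolding svr_eq_average_pairs by (simp add: sum_distrib_left sum_negf mult_ac)
    finally show ?thesis .
  qed
  have "expectation (\<lambda>\<omega>. exp (- (l * (real (n div 2) * svr \<omega>))))
      \<le> expectation (\<lambda>\<omega>. \<Sum>p\<in>?P. 1 / fact n * exp (- (l * pairs p \<omega>)))"
    using le int pairs_mgf(1)[OF _ l]
    by (intro integral_mono) auto
  also have "\<dots> = (\<Sum>p\<in>?P. 1 / fact n * expectation (\<lambda>\<omega>. exp (- (l * pairs p \<omega>))))"
    using pairs_mgf(1)[OF _ l] by (subst Bochner_Integration.integral_sum) auto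
  also have "\<dots> \<le> (\<Sum>p\<in>?P. 1 / fact n * exp (real (n div 2) * (l\<^sup>2 * B\<^sup>2 * v - l * v)))"
    using pairs_mgf(2)[OF _ l] by (intro sum_mono mult_left_mono) auto
  also have "\<dots> = exp (real (n div 2) * (l\<^sup>2 * B\<^sup>2 * v - l * v))"
    by (simp add: cardP)
  finally show "expectation (\<lambda>\<omega>. exp (- (l * (real (n div 2) * svr \<omega>)))) \<le> \<dots>" .
qed

lemma svr_lower_tail:
  assumes c: "c > 0" and v: "v > 0"
  shows "prob {\<omega>\<in>space M. svr \<omega> \<le> v - 2 * B * sqrt (2 * v * c / (real n - 1))} \<le> exp (- c)"
proof -
  define k where "k = real (n div 2)"
  define r where "r = 2 * B * sqrt (2 * v * c / (real n - 1))"
  \<comment> \<open>The minimiser of the Chernoff exponent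
    \<open>k * (l^2 * B^2 * v - l * r)\<close>.\<close>
  define l where "l = r / (2 * B\<^sup>2 * v)"
  have k: "k > 0" and k2: "2 * k \<ge> real n - 1"
    using n2 by (auto simp: k_def)
  have r: "r > 0" and r2: "r\<^sup>2 = 8 * B\<^sup>2 * v * c / (real n - 1)"
    using B v c n2 by (auto simp: r_def power_mult_distrib)
  have l: "l > 0"
    using r B v by (simp add: l_def)
  have "prob {\<omega>\<in>space M. svr \<omega> \<le> v - r} = prob {\<omega>\<in>space M. - (l * (k * svr \<omega>)) \<ge> - (l * (k * (v - r)))}"
    using l k by simp
  also have "\<dots> \<le> exp (k * (l\<^sup>2 * B\<^sup>2 * v - l * v) - - (l * (k * (v - r))))"
    unfolding k_def by (rule Chernoff_bound[OF svr_mgf]) (use l in auto)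
  also have "k * (l\<^sup>2 * B\<^sup>2 * v - l * v) - - (l * (k * (v - r))) = k * l * (l * B\<^sup>2 * v - r)"
    by (simp add: algebra_simps power2_eq_square)
  also have "\<dots> = - (k * r\<^sup>2 / (4 * B\<^sup>2 * v))"
    using B v by (simp add: l_def field_simps power2_eq_square)
  \<comment> \<open>For odd \<open>n\<close> the number \<open>2 * k\<close> is exactly
    \<open>n - 1\<close>; this is why the deviation \<open>r\<close> is scaled by
    \<open>n - 1\<close>.\<close>
  also have "\<dots> = - (2 * k / (real n - 1) * c)"
    using B v n2 unfolding r2 by (simp add: power2_eq_square divide_simps)
  also have "exp \<dots> \<le> exp (- c)"
    using k2 n2 c by (simp add: le_divide_eq)
  finally show ?thesis by (simp add: r_def)
qed

text \<open>Three events of probability at most \<open>exp (- c)\<close> are excluded: the two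
  Bernstein tails and the lower tail of the sample variance. With \<open>b = 2 * B\<close>,
  replacing \<open>\<sigma>\<close> by \<open>s + b * h'\<close> costs
  \<open>b * h' * h' = 6 * b * c / (3 * (n - 1))\<close>; the Bernstein term
  \<open>b * c / (3 * n)\<close> brings the total to at most
  \<open>7 * b * c / (3 * (n - 1))\<close>, whence the constant 14.\<close>

lemma empirical_Bernstein:
  assumes c: "c > 0"
  shows "prob {\<omega>\<in>space M. \<bar>avg \<omega> - m\<bar> \<ge> sqrt (2 * c * svr \<omega> / real n) + c * (14 * B) / (3 * (real n - 1))} \<le> 3 * exp (- c)"
proof -
  define b where "b = 2 * B"
  have n0: "real n - 1 > 0" "real n > 0" "n > 0" using n2 by auto
  define s where "s = (\<lambda>\<omega>. sqrt (svr \<omega>))"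
  define \<sigma> where "\<sigma> = sqrt v"
  define h where "h = sqrt (2 * c / real n)"
  define h' where "h' = sqrt (2 * c / (real n - 1))"
  have ne: "{..<n} \<noteq> {}" using n0 by (auto simp: lessThan_empty_iff)
  have "\<bar>m\<bar> \<le> B"
  proof -
    have "\<bar>expectation (Y 0)\<bar> \<le> expectation (\<lambda>\<omega>. \<bar>Y 0 \<omega>\<bar>)"
      by (rule integral_abs_bound)
    also have "\<dots> \<le> expectation (\<lambda>\<omega>. B)"
      using integrable_Y[of 0] bnd[of 0] n0 by (intro integral_mono_AE) auto
    finally show ?thesis
      using mean[of 0] n0 by (simp add: prob_space)
  qed
  note m_le = this
  have bnd': "AE \<omega> in M. \<bar>Y i \<omega> - m\<bar> \<le> b" if "i < n" for i
    using bnd[OF that] by eventually_elim (use m_le in \<open>auto simp: b_def\<close>)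
  have ind1: "indep_vars (\<lambda>_. borel) (\<lambda>i \<omega>. Y i \<omega> - m) {..<n}"
    and ind2: "indep_vars (\<lambda>_. borel) (\<lambda>i \<omega>. m - Y i \<omega>) {..<n}"
    by (rule indep_vars_compose2[OF indep]; simp)+
  define E1 where "E1 = {\<omega>\<in>space M. (\<Sum>i<n. Y i \<omega> - m) \<ge> sqrt (2 * c * real (card {..<n}) * v) + b * c / 3}"
  define E2 where "E2 = {\<omega>\<in>space M. (\<Sum>i<n. m - Y i \<omega>) \<ge> sqrt (2 * c * real (card {..<n}) * v) + b * c / 3}"
  \<comment> \<open>The lower tail is available for \<open>v > 0\<close>; if \<open>v = 0\<close>,
    then \<open>\<sigma> = 0\<close> and there is nothing to exclude.\<close>
  define E3 where "E3 = (if v = 0 then {} else {\<omega>\<in>space M. svr \<omega> \<le> v - 2 * B * sqrt (2 * v * c / (real n - 1))})"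
  have var: "expectation (\<lambda>\<omega>. (Y i \<omega> - m)\<^sup>2) = v" "expectation (\<lambda>\<omega>. (m - Y i \<omega>)\<^sup>2) = v" if "i < n" for i
    using integrable_Y[OF that] integrable_Y2[OF that] mean[OF that] second_moment[OF that]
    by (simp_all add: power2_diff prob_space) (simp_all add: power2_eq_square)
  have m1: "E1 \<in> events" and m2: "E2 \<in> events"
    unfolding E1_def E2_def by measurable
  have m3: "E3 \<in> events"
    by (cases "v = 0") (simp_all add: E3_def)
  have "prob E1 \<le> exp (-c)"
    unfolding E1_def using bnd' integrable_Y mean var c B
    by (intro Bernstein_upper_tail[OF _ ne ind1]) (auto simp: b_def prob_space)
  moreover have "prob E2 \<le> exp (-c)"
    unfolding E2_def using bnd' integrable_Y mean var c B
    by (intro Bernstein_upper_tail[OF _ ne ind2]) (auto simp: b_def prob_space abs_minus_commute)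
  moreover have "prob E3 \<le> exp (-c)"
    using svr_lower_tail[OF c] v_nonneg by (auto simp: E3_def)
  moreover have "prob {\<omega>\<in>space M. \<bar>avg \<omega> - m\<bar> \<ge> sqrt (2 * c * svr \<omega> / real n) + c * (14 * B) / (3 * (real n - 1))}
      \<le> prob (E1 \<union> E2 \<union> E3)"
  proof (intro finite_measure_mono subsetI)
    fix \<omega> assume "\<omega> \<in> {\<omega>\<in>space M. \<bar>avg \<omega> - m\<bar> \<ge> sqrt (2 * c * svr \<omega> / real n) + c * (14 * B) / (3 * (real n - 1))}"
    then have sp: "\<omega> \<in> space M" and dev: "\<bar>avg \<omega> - m\<bar> \<ge> h * s \<omega> + 7 * b * c / (3 * (real n - 1))"
      by (auto simp: h_def s_def b_def real_sqrt_mult[symmetric] mult_ac)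
    show "\<omega> \<in> E1 \<union> E2 \<union> E3"
    proof (rule ccontr)
      assume no: "\<omega> \<notin> E1 \<union> E2 \<union> E3"
      \<comment> \<open>Outside \<open>E3\<close>,
        \<open>s^2 > \<sigma> * (\<sigma> - b * h')\<close>. If the claim failed, both factors on
        the right would be at least \<open>s\<close>.\<close>
      have "\<sigma> \<le> s \<omega> + b * h'"
      proof (rule ccontr)
        assume "\<not> \<sigma> \<le> s \<omega> + b * h'"
        then have gt: "\<sigma> > s \<omega> + b * h'" by simp
        have s0: "s \<omega> \<ge> 0" "b * h' \<ge> 0"
          using svr_nonneg B c n0 by (auto simp: s_def b_def h'_def)
        then have "\<sigma> > 0" using gt by linarith
        then have v: "v > 0" by (simp add: \<sigma>_def)
        have "svr \<omega> > v - b * (\<sigma> * h')"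
          using no sp v by (simp add: E3_def b_def \<sigma>_def h'_def real_sqrt_mult[symmetric] mult_ac)
        moreover have "v - b * (\<sigma> * h') = \<sigma> * (\<sigma> - b * h')"
          using v by (simp add: \<sigma>_def algebra_simps)
        moreover have "\<sigma> * (\<sigma> - b * h') \<ge> s \<omega> * s \<omega>"
          using gt s0 \<open>\<sigma> > 0\<close> by (intro mult_mono) auto
        moreover have "s \<omega> * s \<omega> = svr \<omega>"
          using svr_nonneg by (simp add: s_def)
        ultimately show False by linarith
      qed
      moreover have "\<bar>avg \<omega> - m\<bar> < h * \<sigma> + b * c / (3 * real n)"
      proof -
        have "sqrt (2 * c * real n * v) = real n * (h * \<sigma>)"
          using n0 c v_nonneg
          by (intro real_sqrt_unique)
            (auto simp: h_def \<sigma>_def power_mult_distrib, simp add: power2_eq_square)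
        moreover have "(\<Sum>i<n. Y i \<omega> - m) = real n * (avg \<omega> - m)" "(\<Sum>i<n. m - Y i \<omega>) = real n * (m - avg \<omega>)"
          using n0 by (auto simp: avg_def sum_subtractf field_simps)
        ultimately have "real n * (avg \<omega> - m) < real n * (h * \<sigma>) + b * c / 3"
          "real n * (m - avg \<omega>) < real n * (h * \<sigma>) + b * c / 3"
          using no sp by (auto simp: E1_def E2_def)
        then have "real n * \<bar>avg \<omega> - m\<bar> < real n * (h * \<sigma>) + b * c / 3"
          by (auto simp: abs_if)
        then show ?thesis
          using n0 by (simp add: field_simps)
      qed
      moreover have "h * \<sigma> + b * c / (3 * real n) \<le> h * s \<omega> + 7 * b * c / (3 * (real n - 1))"
        if "\<sigma> \<le> s \<omega> + b * h'"
      proof -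
        have h: "0 \<le> h" "h \<le> h'" "0 \<le> h'" "h' * h' = 2 * c / (real n - 1)"
          using n0 c by (auto simp: h_def h'_def intro!: divide_left_mono)
        have "h * \<sigma> \<le> h * (s \<omega> + b * h')"
          using that h by (intro mult_left_mono) auto
        also have "\<dots> \<le> h * s \<omega> + b * (h' * h')"
          using mult_right_mono[OF h(2,3)] B by (simp add: b_def algebra_simps)
        also have "b * (h' * h') = 6 * b * c / (3 * (real n - 1))"
          using n0 unfolding h(4) by (simp add: divide_simps)
        finally have "h * \<sigma> \<le> h * s \<omega> + 6 * b * c / (3 * (real n - 1))" .
        moreover have "b * c / (3 * real n) \<le> b * c / (3 * (real n - 1))"
          using n0 B c by (intro divide_left_mono) (auto simp: b_def)
        moreover have "6 * b * c / (3 * (real n - 1)) + b * c / (3 * (real n - 1)) = 7 * b * c / (3 * (real n - 1))"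
          by (simp add: add_divide_distrib[symmetric])
        ultimately show ?thesis by linarith
      qed
      ultimately show False using dev by linarith
    qed
  qed (use m1 m2 m3 in auto)
  moreover have "prob (E1 \<union> E2 \<union> E3) \<le> prob E1 + prob E2 + prob E3"
    using measure_Un_le[OF m1 m2] measure_Un_le[of "E1 \<union> E2" M E3] m1 m2 m3 by auto
  ultimately show ?thesis by linarith
qed

end

section \<open>Minimisers of strongly convex functions\<close>

lemma is_norm_zero [simp]: "is_norm N \<Longrightarrow> N 0 = 0"
  by (simp add: is_norm_def)

lemma is_norm_triangle: "is_norm N \<Longrightarrow> N (x + y) \<le> N x + N y"
  by (simp add: is_norm_def)

lemma is_norm_scaleR: "is_norm N \<Longrightarrow> N (c *\<^sub>R x) = \<bar>c\<bar> * N x"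
  by (simp add: is_norm_def)

lemma is_norm_minus_commute: "is_norm N \<Longrightarrow> N (x - y) = N (y - x)"
  using is_norm_scaleR[of N "-1" "x - y"] by simp

lemma is_norm_nonneg: "is_norm N \<Longrightarrow> 0 \<le> N x"
  using is_norm_triangle[of N x "- x"] is_norm_scaleR[of N "-1" x] by simp

lemma is_norm_diff_le: "is_norm N \<Longrightarrow> N x - N y \<le> N (x - y)"
  using is_norm_triangle[of N "x - y" y] by simp

lemma is_norm_sum: "is_norm N \<Longrightarrow> N (\<Sum>i\<in>I. g i) \<le> (\<Sum>i\<in>I. N (g i))"
proof (induction I rule: infinite_finite_induct)
  case (insert i I)
  then show ?case using is_norm_triangle[of N "g i" "\<Sum>i\<in>I. g i"] by simp
qed auto

lemma is_norm_le_norm: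
  fixes N :: "'a::euclidean_space \<Rightarrow> real"
  assumes "is_norm N"
  obtains C where "C > 0" "\<And>x. N x \<le> C * norm x"
proof
  define C where "C = (\<Sum>b\<in>Basis. N b) + 1"
  have nn: "0 \<le> (\<Sum>b\<in>Basis. N b)"
    by (intro sum_nonneg is_norm_nonneg assms)
  then show "C > 0" by (simp add: C_def)
  show "N x \<le> C * norm x" for x
  proof -
    have "N x = N (\<Sum>b\<in>Basis. (x \<bullet> b) *\<^sub>R b)"
      by (simp add: euclidean_representation)
    also have "\<dots> \<le> (\<Sum>b\<in>Basis. \<bar>x \<bullet> b\<bar> * N b)"
      using is_norm_sum[OF assms, of "\<lambda>b. (x \<bullet> b) *\<^sub>R b" Basis] by (simp add: is_norm_scaleR[OF assms])
    also have "\<dots> \<le> (\<Sum>b\<in>Basis. norm x * N b)"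
      by (intro sum_mono mult_right_mono Basis_le_norm is_norm_nonneg assms)
    also have "\<dots> = norm x * (\<Sum>b\<in>Basis. N b)"
      by (simp add: sum_distrib_left)
    also have "\<dots> \<le> C * norm x"
      by (simp add: C_def algebra_simps)
    finally show ?thesis .
  qed
qed

text \<open>\<open>N\<close> is Lipschitz, so it attains a positive minimum on the compact Euclidean
  unit sphere; homogeneity extends the bound to all vectors.\<close>

lemma norm_le_is_norm:
  fixes N :: "'a::euclidean_space \<Rightarrow> real"
  assumes N: "is_norm N"
  obtains C where "C > 0" "\<And>x. norm x \<le> C * N x"
proof -
  obtain C where C: "C > 0" "\<And>x. N x \<le> C * norm x"
    using is_norm_le_norm[OF N] by blast
  have "C-lipschitz_on UNIV N"
  proof (rule lipschitz_onI)
    show "dist (N x) (N y) \<le> C * dist x y" for x y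
      using is_norm_diff_le[OF N, of x y] is_norm_diff_le[OF N, of y x] C(2)[of "x - y"]
      by (simp add: dist_norm is_norm_minus_commute[OF N, of y x] abs_le_iff)
  qed (use C in simp)
  then have "continuous_on (sphere 0 1) N"
    using lipschitz_on_continuous_on continuous_on_subset by blast
  moreover have "sphere 0 (1::real) \<noteq> ({} :: 'a set)"
    by simp
  ultimately obtain z where z: "z \<in> sphere 0 1" "\<And>y. y \<in> sphere 0 1 \<Longrightarrow> N z \<le> N y"
    using continuous_attains_inf[of "sphere 0 1" N] by auto
  have "N z \<noteq> 0"
    using z(1) N by (auto simp: is_norm_def)
  then have pos: "N z > 0"
    using is_norm_nonneg[OF N, of z] by simp
  show ?thesis
  proof
    show "1 / N z > 0" using pos by simp
    show "norm x \<le> 1 / N z * N x" for x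
    proof (cases "x = 0")
      case False
      then have "N z \<le> N ((1 / norm x) *\<^sub>R x)"
        by (intro z(2)) simp
      also have "\<dots> = N x / norm x"
        by (simp add: is_norm_scaleR[OF N])
      finally show ?thesis
        using False pos by (simp add: field_simps)
    qed (use N in simp)
  qed
qed

lemma coercive_attains_inf:
  fixes G :: "'a::heine_borel \<Rightarrow> real"
  assumes "closed X" "z \<in> X" "continuous_on X G"
    and coercive: "\<And>y. y \<in> X \<Longrightarrow> dist z y > R \<Longrightarrow> G z \<le> G y"
  shows "\<exists>w\<in>X. \<forall>y\<in>X. G w \<le> G y"
proof -
  \<comment> \<open>The absolute value keeps \<open>z\<close> in the ball even for negative
    \<open>R\<close>.\<close>
  let ?X = "X \<inter> cball z \<bar>R\<bar>"
  have "compact ?X" "?X \<noteq> {}" "continuous_on ?X G"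
    using assms by (auto intro: closed_Int_compact continuous_on_subset)
  then obtain w where w: "w \<in> ?X" "\<And>y. y \<in> ?X \<Longrightarrow> G w \<le> G y"
    using continuous_attains_inf by metis
  have "G w \<le> G y" if "y \<in> X" for y
  proof (cases "dist z y \<le> \<bar>R\<bar>")
    case True
    then show ?thesis using that w by simp
  next
    case False
    then have "G z \<le> G y" using that by (intro coercive) auto
    moreover have "G w \<le> G z" using assms by (intro w) auto
    ultimately show ?thesis by simp
  qed
  then show ?thesis using w by blast
qed

text \<open>Optimality of the proximal point w for z supplies the one subgradient that makes strong
  convexity applicable.\<close>
lemma proximal_point_subgradient:
  fixes F :: "'a::real_inner \<Rightarrow> real"
  assumes F: "convex_on X F" and X: "w \<in> X" "y \<in> X"
    and opt: "\<And>y. y \<in> X \<Longrightarrow> F w + (norm (w - z))\<^sup>2 / 2 \<le> F y + (norm (y - z))\<^sup>2 / 2"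
  shows "F w + (z - w) \<bullet> (y - w) \<le> F y"
proof -
  define a where "a = (w - z) \<bullet> (y - w)"
  define q where "q = (norm (y - w))\<^sup>2"
  define A where "A = F y - F w + a"
  define Q where "Q = q / 2"
  \<comment> \<open>Optimality of \<open>w\<close> is tested against points on the segment towards
    \<open>y\<close>. Division by \<open>t\<close> and the limit \<open>t\<close> to 0 from the
    right remove the second-order term.\<close>
  have "0 \<le> A + t * Q" if t: "0 < t" "t < 1" for t
  proof -
    let ?p = "w + t *\<^sub>R (y - w)"
    have p: "?p = (1 - t) *\<^sub>R w + t *\<^sub>R y"
      by (simp add: algebra_simps)
    have "?p \<in> X"
      unfolding p using F X t by (intro convexD) (auto simp: convex_on_def)
    then have "F w + (norm (w - z))\<^sup>2 / 2 \<le> F ?p + (norm (?p - z))\<^sup>2 / 2"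
      by (rule opt)
    also have "F ?p \<le> (1 - t) * F w + t * F y"
      unfolding p using F X t by (intro convex_onD) auto
    also have "(norm (?p - z))\<^sup>2 = (norm (w - z))\<^sup>2 + 2 * t * a + t\<^sup>2 * q"
    proof -
      have "?p - z = (w - z) + t *\<^sub>R (y - w)" by simp
      then show ?thesis
        unfolding a_def q_def power2_norm_eq_inner
        by (simp add: inner_add_left inner_add_right inner_commute power2_eq_square algebra_simps del: scaleR_diff_right)
    qed
    finally have "0 \<le> t * (A + t * Q)"
      by (simp add: A_def Q_def algebra_simps power2_eq_square add_divide_distrib)
    then show ?thesis
      using t by (simp add: zero_le_mult_iff)
  qed
  then have "\<forall>\<^sub>F t in at_right 0. 0 \<le> A + t * Q"
    unfolding eventually_at_right_field by (intro exI[of _ "1::real"]) auto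
  moreover have "((\<lambda>t. A + t * Q) \<longlongrightarrow> A + 0 * Q) (at_right 0)"
    by (intro tendsto_intros)
  ultimately have "0 \<le> A + 0 * Q"
    by (intro tendsto_lowerbound) auto
  then show ?thesis
    by (simp add: A_def a_def algebra_simps inner_commute)
qed

text \<open>Strong convexity is stated through subgradients, so one must first be produced.
  \<open>F\<close> decreases at most linearly, hence adding a quadratic anchored at \<open>z\<close>
  gives a coercive function, whose minimiser \<open>w\<close> carries the subgradient
  \<open>z - w\<close>. Strong convexity at \<open>w\<close> then makes \<open>F\<close> itself
  coercive.\<close>

lemma strongly_convex_attains_inf:
  fixes F :: "'a::euclidean_space \<Rightarrow> real"
  assumes N: "is_norm N" and X: "closed X" "X \<noteq> {}" and F: "convex_on X F"
    and Lip: "\<And>y y'. y \<in> X \<Longrightarrow> y' \<in> X \<Longrightarrow> \<bar>F y - F y'\<bar> \<le> L * N (y - y')"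
    and sc: "strongly_convex_wrt N X F \<mu>" and \<mu>: "\<mu> > 0"
  shows "\<exists>w\<in>X. \<forall>y\<in>X. F w \<le> F y"
proof -
  obtain C where C: "C > 0" "\<And>x. N x \<le> C * norm x"
    using is_norm_le_norm[OF N] by blast
  obtain C' where C': "C' > 0" "\<And>x. norm x \<le> C' * N x"
    using norm_le_is_norm[OF N] by blast
  define \<Lambda> where "\<Lambda> = \<bar>L\<bar> * C"
  have Lip': "\<bar>F y - F y'\<bar> \<le> \<Lambda> * norm (y - y')" if "y \<in> X" "y' \<in> X" for y y'
  proof -
    have "\<bar>F y - F y'\<bar> \<le> L * N (y - y')" by (rule Lip[OF that])
    also have "\<dots> \<le> \<bar>L\<bar> * N (y - y')"
      by (intro mult_right_mono is_norm_nonneg N) simp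
    also have "\<dots> \<le> \<bar>L\<bar> * (C * norm (y - y'))"
      by (intro mult_left_mono C) simp
    finally show ?thesis by (simp add: \<Lambda>_def mult.assoc)
  qed
  have "\<Lambda>-lipschitz_on X F"
    using Lip' C by (intro lipschitz_onI) (auto simp: dist_norm \<Lambda>_def)
  then have cont: "continuous_on X F"
    by (rule lipschitz_on_continuous_on)
  obtain z where z: "z \<in> X" using X by blast
  define G where "G = (\<lambda>y. F y + (norm (y - z))\<^sup>2 / 2)"
  have "\<exists>w\<in>X. \<forall>y\<in>X. G w \<le> G y"
  \<comment> \<open>Beyond distance \<open>2 * \<Lambda>\<close> half the squared distance dominates
    the largest possible decrease of \<open>F\<close>.\<close>
  proof (rule coercive_attains_inf[where R = "2 * \<Lambda>", OF X(1) z])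
    show "continuous_on X G"
      unfolding G_def by (intro continuous_intros cont) simp
    fix y assume y: "y \<in> X" "dist z y > 2 * \<Lambda>"
    then have r: "norm (y - z) > 2 * \<Lambda>"
      by (simp add: dist_norm norm_minus_commute)
    have "\<Lambda> * norm (y - z) \<le> norm (y - z) / 2 * norm (y - z)"
      using r by (intro mult_right_mono) auto
    then show "G z \<le> G y"
      using Lip'[OF y(1) z] by (simp add: G_def power2_eq_square)
  qed
  then obtain w where w: "w \<in> X" "\<And>y. y \<in> X \<Longrightarrow> G w \<le> G y" by blast
  define g where "g = z - w"
  have "F w + g \<bullet> (y - w) \<le> F y" if "y \<in> X" for y
    unfolding g_def using w that by (intro proximal_point_subgradient[OF F]) (auto simp: G_def)
  then have grow: "F u \<ge> F w + g \<bullet> (u - w) + \<mu> / 2 * (N (u - w))\<^sup>2" if "u \<in> X" for u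
    using sc w(1) that unfolding strongly_convex_wrt_def by blast
  show ?thesis
  \<comment> \<open>Beyond this radius the growth \<open>\<mu> / 2 * (r / C')^2\<close> outweighs
    the linear term, which is at least \<open>- norm g * r\<close>.\<close>
  proof (rule coercive_attains_inf[where R = "2 * norm g * C'\<^sup>2 / \<mu>", OF X(1) w(1) cont])
    fix y assume y: "y \<in> X" "dist w y > 2 * norm g * C'\<^sup>2 / \<mu>"
    define r where "r = norm (y - w)"
    have r: "r > 2 * norm g * C'\<^sup>2 / \<mu>"
      using y by (simp add: r_def dist_norm norm_minus_commute)
    have r0: "r \<ge> 0" by (simp add: r_def)
    have "norm g \<le> \<mu> / 2 * r / C'\<^sup>2"
      using r \<mu> C' by (simp add: field_simps)
    then have "norm g * r \<le> \<mu> / 2 * r / C'\<^sup>2 * r"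
      by (intro mult_right_mono r0)
    also have "\<dots> = \<mu> / 2 * (r / C')\<^sup>2"
      by (simp add: power2_eq_square)
    also have "\<dots> \<le> \<mu> / 2 * (N (y - w))\<^sup>2"
      using C'(2)[of "y - w"] C'(1) \<mu> r0 unfolding r_def
      by (intro mult_left_mono power_mono) (auto simp: field_simps)
    finally have "norm g * r \<le> \<mu> / 2 * (N (y - w))\<^sup>2" .
    moreover have "- (norm g * r) \<le> g \<bullet> (y - w)"
      using Cauchy_Schwarz_ineq2[of g "y - w"] by (simp add: r_def abs_le_iff)
    ultimately show "F w \<le> F y"
      using grow[OF y(1)] by linarith
  qed
qed

text \<open>At a minimiser the zero vector is a subgradient.\<close>

lemma strongly_convex_quadratic_growth:
  assumes sc: "strongly_convex_wrt N X F \<mu>" and w: "w \<in> X" "\<And>y. y \<in> X \<Longrightarrow> F w \<le> F y" and "u \<in> X"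
  shows "F w + \<mu> / 2 * (N (u - w))\<^sup>2 \<le> F u"
  using assms unfolding strongly_convex_wrt_def
  by (metis (no_types, lifting) add.right_neutral inner_zero_left)

section \<open>Deterministic analysis of the selection rule\<close>

lemma rms_outputD:
  assumes "rms_output Fb t \<gamma> K kr"
  shows "kr \<le> K" "\<And>k. k \<le> K \<Longrightarrow> Fb kr + t kr \<le> Fb k + \<gamma> * t k"
    and "\<And>k. k \<le> K \<Longrightarrow> (\<And>j. j \<le> K \<Longrightarrow> Fb k + t k \<le> Fb j + \<gamma> * t j) \<Longrightarrow> Fb kr \<le> Fb k"
  using assms by (auto simp: rms_output_def Let_def)

text \<open>\<open>d\<close> stands for the distance to the best candidate and \<open>e\<close> for
  the distance to the minimiser; \<open>h\<close> and \<open>\<rho>\<close> are the Lipschitz slopes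
  of deviation and width.\<close>

lemma rms_output_vs_best:
  assumes out: "rms_output Fb t \<gamma> K kr" and \<gamma>: "\<gamma> \<ge> 3" and \<mu>: "\<mu> > 0" and ks: "ks \<le> K"
    and rel: "\<And>k. k \<le> K \<Longrightarrow> \<bar>(Fb k - Fb 0) - (F k - F 0)\<bar> \<le> t k"
    and dev: "\<And>k. k \<le> K \<Longrightarrow> Fb ks - Fb k \<le> F ks - F k + h * d k"
    and t_Lip: "\<And>k. k \<le> K \<Longrightarrow> t ks \<le> t k + \<rho> * d k"
    and d: "\<And>k. k \<le> K \<Longrightarrow> d k \<le> e k + e ks"
    and growth: "\<And>k. k \<le> K \<Longrightarrow> Fs + \<mu> / 2 * (e k)\<^sup>2 \<le> F k"
    and h: "h \<ge> 0" and \<rho>: "\<rho> \<ge> 0"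
  shows "F kr - Fs \<le> 4 * (F ks - Fs) + 4 / \<mu> * (h + \<rho>)\<^sup>2"
proof -
  note kr = rms_outputD[OF out]
  \<comment> \<open>Young's inequality with a free weight \<open>s\<close>, which fixes how much
    quadratic growth each linear term uses up.\<close>
  have amgm: "a * b \<le> s * \<mu> * b\<^sup>2 + a\<^sup>2 / (4 * s * \<mu>)" if "s > 0" for a b s
  proof -
    have "0 \<le> (2 * s * \<mu> * b - a)\<^sup>2 / (4 * s * \<mu>)"
      using that \<mu> by simp
    also have "\<dots> = s * \<mu> * b\<^sup>2 + a\<^sup>2 / (4 * s * \<mu>) - a * b"
      using that \<mu> by (simp add: power2_eq_square field_simps)
    finally show ?thesis by simp
  qed
  have Ds: "F ks - Fs \<ge> 0"
  proof -
    have "0 \<le> \<mu> / 2 * (e ks)\<^sup>2" using \<mu> by simp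
    then show ?thesis using growth[OF ks] by linarith
  qed
  show ?thesis
  proof (cases "\<forall>j\<le>K. Fb ks + t ks \<le> Fb j + \<gamma> * t j")
    case True
    then have "Fb kr \<le> Fb ks"
      using kr(3)[OF ks] by blast
    then have "F kr - F ks \<le> h * d kr"
      using dev[OF kr(1)] by linarith
    also have "\<dots> \<le> h * e kr + h * e ks"
      using mult_left_mono[OF d[OF kr(1)] h] by (simp add: algebra_simps)
    \<comment> \<open>Weight 1/4 costs half of the gap at \<open>kr\<close> and half of the gap at
      \<open>ks\<close>. Moving the former to the left and doubling gives the factor 3.\<close>
    also have "\<dots> \<le> (1/4 * \<mu> * (e kr)\<^sup>2 + h\<^sup>2 / \<mu>) + (1/4 * \<mu> * (e ks)\<^sup>2 + h\<^sup>2 / \<mu>)"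
      using amgm[of "1/4" h "e kr"] amgm[of "1/4" h "e ks"] by (intro add_mono) auto
    finally have "F kr - Fs \<le> 3 * (F ks - Fs) + 4 * (h\<^sup>2 / \<mu>)"
      using growth[OF kr(1)] growth[OF ks] by (simp add: algebra_simps)
    moreover have "h\<^sup>2 / \<mu> \<le> (h + \<rho>)\<^sup>2 / \<mu>"
      using h \<rho> \<mu> by (intro divide_right_mono power_mono) auto
    ultimately show ?thesis
      using Ds by simp
  next
    case False
    then obtain j where j: "j \<le> K" "Fb j + \<gamma> * t j < Fb ks + t ks"
      by (auto simp: not_le)
    define H where "H = h + \<rho>"
    have H: "H \<ge> 0" using h \<rho> by (simp add: H_def)
    have "F kr \<le> F j + (1 + \<gamma>) * t j"
      using kr(2)[OF j(1)] rel[OF kr(1)] rel[OF j(1)] by (simp add: algebra_simps abs_le_iff)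
    \<comment> \<open>Here \<open>\<gamma> \<ge> 3\<close> enters. Infeasibility of
      \<open>ks\<close> together with the Lipschitz bound on the width controls
      \<open>(\<gamma> - 1) * t j\<close>.\<close>
    also have "(1 + \<gamma>) * t j \<le> 2 * (\<gamma> - 1) * t j"
      using rel[OF j(1)] \<gamma> by (intro mult_right_mono) auto
    also have "(\<gamma> - 1) * t j \<le> F ks - F j + H * d j"
      using j(2) dev[OF j(1)] t_Lip[OF j(1)] by (simp add: H_def algebra_simps)
    then have "2 * (\<gamma> - 1) * t j \<le> 2 * (F ks - F j + H * d j)"
      unfolding mult.assoc by (intro mult_left_mono) simp_all
    also have "H * d j \<le> H * e j + H * e ks"
      using mult_left_mono[OF d[OF j(1)] H] by (simp add: algebra_simps)
    finally have "F kr \<le> 2 * F ks - F j + (2 * H * e j + 2 * H * e ks)"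
      by simp
    \<comment> \<open>Weight 1/2 at \<open>j\<close> is paid for exactly by the term
      \<open>- F j\<close>; weight 1 at \<open>ks\<close> adds two gaps to the two already
      present.\<close>
    also have "2 * H * e j + 2 * H * e ks \<le> (1/2 * \<mu> * (e j)\<^sup>2 + 2 * (H\<^sup>2 / \<mu>)) + (1 * \<mu> * (e ks)\<^sup>2 + H\<^sup>2 / \<mu>)"
      using amgm[of "1/2" "2 * H" "e j"] amgm[of 1 "2 * H" "e ks"] by (intro add_mono) auto
    finally have "F kr - Fs \<le> 4 * (F ks - Fs) + 3 * (H\<^sup>2 / \<mu>)"
      using growth[OF j(1)] growth[OF ks] by (simp add: algebra_simps)
    moreover have "H\<^sup>2 / \<mu> \<ge> 0" using \<mu> by simp
    ultimately show ?thesis by (simp add: H_def)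
  qed
qed

text \<open>The width has \<open>n - 1\<close> where the claimed bound \<open>W\<close> has \<open>n\<close>, so \<open>t \<le> W\<close> can fail. Unless \<open>(1 + \<gamma>) W\<close>
  exceeds the trivial bound \<open>M\<close>, however, \<open>\<gamma>\<close> is so small that the excess \<open>\<gamma> (t - W)\<close> fits into the gap
  between \<open>W\<close> and the Hoeffding deviation.\<close>
lemma width_bound_or_trivial:
  fixes n c M M' \<gamma> t :: real
  assumes n: "n \<ge> 2" and c: "c > 1" and M: "0 \<le> M" "M \<le> M'" and \<gamma>: "\<gamma> \<ge> 1"
    and t: "t \<le> sqrt (2 * c / (n - 1)) * M + 14 * c * M' / (3 * (n - 1))"
  defines "W \<equiv> sqrt (2 * c / n) * M + 14 * c * M' / (3 * n)"
  shows "M \<le> (1 + \<gamma>) * W \<or> sqrt (2 * c / n) * M + \<gamma> * t \<le> (1 + \<gamma>) * W"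
proof (cases "M \<le> (1 + \<gamma>) * W")
  case False
  then have lt: "(1 + \<gamma>) * W < M" by simp
  define h where "h = sqrt (2 * c / n)"
  have h: "h \<ge> 0" using n c by (simp add: h_def)
  have hM: "h * M \<ge> 0" "14 * c * M' / (3 * n) \<ge> 0" "14 * c * M / (3 * n) \<ge> 0" "14 * c * M / (3 * n) \<le> 14 * c * M' / (3 * n)"
    using h M n c by (auto intro!: divide_right_mono)
  have "(1 + \<gamma>) * (h * M) \<le> (1 + \<gamma>) * W"
    unfolding W_def h_def[symmetric] using hM \<gamma> by (intro mult_left_mono) auto
  then have 1: "((1 + \<gamma>) * h) * M < 1 * M"
    using lt by simp
  have "(1 + \<gamma>) * (14 * c * M / (3 * n)) \<le> (1 + \<gamma>) * W"
    unfolding W_def h_def[symmetric] using hM \<gamma> by (intro mult_left_mono) auto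
  moreover have "((1 + \<gamma>) * 14 * c / (3 * n)) * M = (1 + \<gamma>) * (14 * c * M / (3 * n))"
    by simp
  ultimately have 2: "((1 + \<gamma>) * 14 * c / (3 * n)) * M < 1 * M"
    using lt by linarith
  have "M > 0" using 1 M by (cases "M = 0") auto
  with 1 2 have g1: "(1 + \<gamma>) * h < 1" and g2: "(1 + \<gamma>) * 14 * c / (3 * n) < 1"
    by (simp_all only: mult_less_cancel_right_pos)
  have "\<gamma> * h \<le> 1" using g1 h by (simp add: algebra_simps)
  have "(1 + \<gamma>) * 14 * 1 \<le> (1 + \<gamma>) * 14 * c"
    using \<gamma> c by (intro mult_left_mono) auto
  also have "\<dots> < 3 * n"
    using g2 n by (simp add: divide_less_eq)
  \<comment> \<open>From \<open>14 * (1 + \<gamma>) < 3 * n\<close>.\<close>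
  finally have \<gamma>n: "\<gamma> \<le> (n - 1) / 2" using n by simp
  \<comment> \<open>Bernoulli's inequality for
    \<open>sqrt (n / (n - 1)) = sqrt (1 + 1 / (n - 1))\<close>.\<close>
  have "sqrt (2 * c / (n - 1)) \<le> h * (1 + 1 / (2 * (n - 1)))"
  proof (rule real_le_lsqrt)
    have "2 * c / (n - 1) = (2 * c / n) * (1 + 1 / (n - 1))"
      using n by (simp add: field_simps)
    also have "\<dots> \<le> (2 * c / n) * (1 + 1 / (2 * (n - 1)))\<^sup>2"
    proof (intro mult_left_mono)
      have "1 / (n - 1) = 2 * (1 / (2 * (n - 1)))"
        using n by (simp add: divide_simps)
      then show "1 + 1 / (n - 1) \<le> (1 + 1 / (2 * (n - 1)))\<^sup>2"
        unfolding power2_sum by simp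
    qed (use n c in auto)
    also have "\<dots> = (h * (1 + 1 / (2 * (n - 1))))\<^sup>2"
      using n c by (simp add: power_mult_distrib h_def)
    finally show "2 * c / (n - 1) \<le> \<dots>" .
  qed (use n c h in auto)
  then have "sqrt (2 * c / (n - 1)) * M \<le> h * (1 + 1 / (2 * (n - 1))) * M"
    using M by (intro mult_right_mono)
  then have "t \<le> h * M + h * M / (2 * (n - 1)) + 14 * c * M' / (3 * (n - 1))"
    using t by (simp add: algebra_simps)
  also have "14 * c * M' / (3 * (n - 1)) = 14 * c * M' / (3 * n) + 14 * c * M' / (3 * n) / (n - 1)"
    using n by (simp add: divide_simps) (simp add: algebra_simps)
  finally have "t - W \<le> h * M / (2 * (n - 1)) + 14 * c * M' / (3 * n) / (n - 1)"
    by (simp add: W_def h_def)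
  then have "\<gamma> * (t - W) \<le> \<gamma> * (h * M / (2 * (n - 1)) + 14 * c * M' / (3 * n) / (n - 1))"
    using \<gamma> by (intro mult_left_mono) auto
  also have "\<dots> = \<gamma> * h * M / (2 * (n - 1)) + \<gamma> * (14 * c * M' / (3 * n)) / (n - 1)"
    by (simp add: algebra_simps)
  \<comment> \<open>The available gap \<open>14 * c * M' / (3 * n)\<close> is split evenly: the
    square-root excess uses \<open>\<gamma> * h \<le> 1\<close>, the linear excess uses
    \<open>\<gamma> \<le> (n - 1) / 2\<close>.\<close>
  also have "\<gamma> * h * M / (2 * (n - 1)) \<le> 7 * c * M' / (3 * n)"
  proof -
    have "\<gamma> * h * M \<le> 1 * M'"
      using \<open>\<gamma> * h \<le> 1\<close> M by (intro mult_mono) auto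
    then have "\<gamma> * h * M / (2 * (n - 1)) \<le> M' / (2 * (n - 1))"
      using n by (intro divide_right_mono) auto
    also have "\<dots> \<le> M' / n"
      using n M by (intro divide_left_mono) auto
    also have "\<dots> \<le> 7 * c * M' / 3 / n"
      using n M c mult_right_mono[of 1 c M'] by (intro divide_right_mono) auto
    finally show ?thesis by simp
  qed
  also have "\<gamma> * (14 * c * M' / (3 * n)) / (n - 1) \<le> (n - 1) / 2 * (14 * c * M' / (3 * n)) / (n - 1)"
    using \<gamma>n hM n by (intro divide_right_mono mult_right_mono) auto
  also have "\<dots> = 7 * c * M' / (3 * n)"
    using n by (simp add: divide_simps)
  finally have "\<gamma> * (t - W) \<le> 14 * c * M' / (3 * n)" by (simp add: mult_ac)
  then have "\<gamma> * t \<le> \<gamma> * W + 14 * c * M' / (3 * n)"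
    by (simp add: right_diff_distrib)
  moreover have "(1 + \<gamma>) * W = sqrt (2 * c / n) * M + 14 * c * M' / (3 * n) + \<gamma> * W"
    by (simp add: distrib_right W_def)
  ultimately have "sqrt (2 * c / n) * M + \<gamma> * t \<le> (1 + \<gamma>) * W" by simp
  then show ?thesis ..
qed simp

section \<open>Concentration of the empirical risk\<close>

lemma Fbar_diff: "Fbar f n S y - Fbar f n S z = (\<Sum>i<n. f y (S i) - f z (S i)) / real n"
  by (simp add: Fbar_def sum_subtractf diff_divide_distrib)

lemma svar_zero [simp]: "svar f n S 0 = 0"
  by (simp add: svar_def)

lemma svar_nonneg: "n \<ge> 2 \<Longrightarrow> svar f n S y \<ge> 0"
  unfolding svar_def by (intro divide_nonneg_nonneg sum_nonneg) auto

lemma tau_zero: "is_norm N \<Longrightarrow> tau N Lhat c f n S 0 = 0"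
  by (simp add: tau_def)

text \<open>Up to scaling, \<open>sqrt svar\<close> is the L2 norm of the centred increments, so
  Minkowski applies. Centring the differences does not increase their L2 norm.\<close>

lemma sqrt_svar_le:
  assumes n: "n \<ge> 2" and M: "M \<ge> 0" and bnd: "\<And>i. i < n \<Longrightarrow> \<bar>f y (S i) - f z (S i)\<bar> \<le> M"
  shows "sqrt (svar f n S y) \<le> sqrt (svar f n S z) + sqrt (real n / (real n - 1)) * M"
proof -
  define dev where "dev = (\<lambda>y i. f y (S i) - f 0 (S i) - (Fbar f n S y - Fbar f n S 0))"
  define w where "w = (\<lambda>i. f y (S i) - f z (S i))"
  define e where "e = (\<lambda>i. w i - (\<Sum>j<n. w j) / real n)"
  have ne: "{..<n} \<noteq> {}" using n by (auto simp: lessThan_empty_iff)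
  have svar: "sqrt (svar f n S y) = L2_set (dev y) {..<n} / sqrt (real n - 1)" for y
    by (simp add: svar_def dev_def L2_set_def real_sqrt_divide)
  have "dev y = (\<lambda>i. dev z i + e i)"
    unfolding dev_def e_def w_def Fbar_diff[symmetric] by (simp add: fun_eq_iff)
  then have "L2_set (dev y) {..<n} = L2_set (\<lambda>i. dev z i + e i) {..<n}" by simp
  also have "\<dots> \<le> L2_set (dev z) {..<n} + L2_set e {..<n}"
    by (rule L2_set_triangle_ineq)
  also have "L2_set e {..<n} \<le> sqrt (real n) * M"
    unfolding L2_set_def
  proof (rule real_le_lsqrt)
    have "(\<Sum>i<n. (e i)\<^sup>2) \<le> (\<Sum>i<n. (w i)\<^sup>2)"
      using sum_deviations_le[OF _ ne, of w] by (simp add: e_def)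
    also have "\<dots> \<le> (\<Sum>i<n. M\<^sup>2)"
      using bnd by (intro sum_mono) (auto simp: w_def abs_le_square_iff[symmetric] M)
    finally show "(\<Sum>i<n. (e i)\<^sup>2) \<le> (sqrt (real n) * M)\<^sup>2"
      by (simp add: power_mult_distrib)
  qed (use M in auto)
  finally have "L2_set (dev y) {..<n} \<le> L2_set (dev z) {..<n} + sqrt (real n) * M" by simp
  then show ?thesis
    unfolding svar using n
    by (simp add: real_sqrt_divide add_divide_distrib[symmetric] divide_right_mono)
qed

text \<open>The factor \<open>sqrt (n / (n - 1))\<close> turns \<open>sqrt (2 * c / n)\<close> into
  \<open>sqrt (2 * c / (n - 1))\<close>. With \<open>z = 0\<close>, where the width vanishes, this
  bounds a width outright; between two candidates it is a Lipschitz estimate.\<close>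

lemma tau_le:
  assumes n: "n \<ge> 2" and c: "c \<ge> 0" and M: "M \<ge> 0" and bnd: "\<And>i. i < n \<Longrightarrow> \<bar>f y (S i) - f z (S i)\<bar> \<le> M"
    and M': "Lhat * N y \<le> Lhat * N z + M'"
  shows "tau N Lhat c f n S y \<le> tau N Lhat c f n S z + (sqrt (2 * c / (real n - 1)) * M + 14 * c * M' / (3 * (real n - 1)))"
proof -
  have sq: "sqrt (2 * c * svar f n S y / real n) = sqrt (2 * c / real n) * sqrt (svar f n S y)" for y
    by (simp add: real_sqrt_mult[symmetric] real_sqrt_divide)
  have "sqrt (2 * c / real n) * sqrt (svar f n S y)
      \<le> sqrt (2 * c / real n) * (sqrt (svar f n S z) + sqrt (real n / (real n - 1)) * M)"
    using c bnd by (intro mult_left_mono sqrt_svar_le n M) auto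
  also have "\<dots> = sqrt (2 * c / real n) * sqrt (svar f n S z) + sqrt (2 * c / (real n - 1)) * M"
  proof -
    have "sqrt (2 * c / real n) * sqrt (real n / (real n - 1)) = sqrt (2 * c / (real n - 1))"
      using n by (subst real_sqrt_mult[symmetric]) simp
    then show ?thesis
      by (simp add: distrib_left mult.assoc[symmetric])
  qed
  finally have 1: "sqrt (2 * c * svar f n S y / real n) \<le> sqrt (2 * c * svar f n S z / real n) + sqrt (2 * c / (real n - 1)) * M"
    unfolding sq .
  have "c * (14 * Lhat * N y) / (3 * (real n - 1)) \<le> (14 * c) * (Lhat * N z + M') / (3 * (real n - 1))"
    using mult_left_mono[OF M', of "14 * c"] c n by (intro divide_right_mono) (auto simp: mult_ac)
  also have "\<dots> = c * (14 * Lhat * N z) / (3 * (real n - 1)) + 14 * c * M' / (3 * (real n - 1))"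
    by (simp add: algebra_simps add_divide_distrib)
  finally show ?thesis
    using 1 unfolding tau_def by linarith
qed

section \<open>Lipschitz losses under the product measure of an i.i.d. sample\<close>

locale lipschitz_sample = D: prob_space D for D :: "'s measure" +
  fixes N :: "'a::euclidean_space \<Rightarrow> real" and X :: "'a set" and f :: "'a \<Rightarrow> 's \<Rightarrow> real"
    and n :: nat and L :: real
  assumes norm: "is_norm N" and n2: "n \<ge> 2" and zeroX: "0 \<in> X"
    and fint: "\<And>y. y \<in> X \<Longrightarrow> integrable D (f y)"
    and Lip: "AE s in D. \<forall>y\<in>X. \<forall>y'\<in>X. \<bar>f y s - f y' s\<bar> \<le> L * N (y - y')"
begin

abbreviation P :: "(nat \<Rightarrow> 's) measure" where
  "P \<equiv> PiM {..<n} (\<lambda>_. D)"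

abbreviation F :: "'a \<Rightarrow> real" where
  "F y \<equiv> integral\<^sup>L D (f y)"

sublocale P: prob_space P
  by (rule prob_space_PiM) (rule D.prob_space_axioms)

lemma f_measurable [measurable]: "y \<in> X \<Longrightarrow> f y \<in> borel_measurable D"
  using fint by blast

lemma Fbar_measurable [measurable]: "y \<in> X \<Longrightarrow> (\<lambda>S. Fbar f n S y) \<in> borel_measurable P"
  unfolding Fbar_def by measurable

lemma tau_measurable [measurable]: "y \<in> X \<Longrightarrow> (\<lambda>S. tau N Lhat c f n S y) \<in> borel_measurable P"
  unfolding tau_def svar_def using zeroX by measurable

lemma Lip_AE: "y \<in> X \<Longrightarrow> y' \<in> X \<Longrightarrow> AE s in D. \<bar>f y s - f y' s\<bar> \<le> L * N (y - y')"
  by (rule eventually_mono[OF Lip]) blast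

text \<open>Supplies the sign of the product; \<open>L\<close> itself may be negative when
  \<open>X\<close> is a single point.\<close>

lemma Lip_bound_nonneg:
  assumes "y \<in> X" "y' \<in> X"
  shows "0 \<le> L * N (y - y')"
proof -
  have "AE s in D. 0 \<le> L * N (y - y')"
    by (rule eventually_mono[OF Lip_AE[OF assms]]) linarith
  then show ?thesis by simp
qed

lemma Lip_sample_AE: "y \<in> X \<Longrightarrow> y' \<in> X \<Longrightarrow> i < n \<Longrightarrow> AE S in P. \<bar>f y (S i) - f y' (S i)\<bar> \<le> L * N (y - y')"
  using AE_PiM_component[of "{..<n}" "\<lambda>_. D" i "\<lambda>s. \<bar>f y s - f y' s\<bar> \<le> L * N (y - y')"]
    Lip_AE D.prob_space_axioms by simp

lemma F_Lip: "y \<in> X \<Longrightarrow> y' \<in> X \<Longrightarrow> \<bar>F y - F y'\<bar> \<le> L * N (y - y')"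
proof -
  assume y: "y \<in> X" "y' \<in> X"
  have "\<bar>F y - F y'\<bar> = \<bar>integral\<^sup>L D (\<lambda>s. f y s - f y' s)\<bar>"
    using fint y by simp
  also have "\<dots> \<le> integral\<^sup>L D (\<lambda>s. \<bar>f y s - f y' s\<bar>)"
    by (rule integral_abs_bound)
  also have "\<dots> \<le> integral\<^sup>L D (\<lambda>s. L * N (y - y'))"
    using fint y Lip_AE[OF y] by (intro integral_mono_AE) auto
  finally show ?thesis by (simp add: D.prob_space)
qed

text \<open>The law of the identity on the product space is the product of the coordinate laws,
  which is independence of the coordinates.\<close>

lemma indep_sample:
  assumes [measurable]: "Z \<in> borel_measurable D"
  shows "P.indep_vars (\<lambda>_. borel) (\<lambda>i S. Z (S i)) {..<n}"
proof -
  have ne: "{..<n} \<noteq> {}" using n2 by (auto simp: lessThan_empty_iff)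
  have "P.indep_vars (\<lambda>_. D) (\<lambda>i S. S i) {..<n}"
  proof (subst P.indep_vars_iff_distr_eq_PiM'[OF ne])
    have "distr P P (\<lambda>S. \<lambda>i\<in>{..<n}. S i) = distr P P (\<lambda>S. S)"
      by (intro distr_cong refl) (auto simp: space_PiM PiE_def extensional_restrict)
    also have "\<dots> = P" by (rule distr_id2) simp
    also have "P = PiM {..<n} (\<lambda>i. distr P D (\<lambda>S. S i))"
      by (intro PiM_cong refl distr_PiM_component[symmetric] D.prob_space_axioms)
    finally show "distr P P (\<lambda>S. \<lambda>i\<in>{..<n}. S i) = PiM {..<n} (\<lambda>i. distr P D (\<lambda>S. S i))" .
  qed simp
  then show ?thesis
    by (rule P.indep_vars_compose2) simp
qed

lemma expectation_sample:
  assumes [measurable]: "Z \<in> borel_measurable D" and "i < n"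
  shows "P.expectation (\<lambda>S. Z (S i)) = (integral\<^sup>L D Z :: real)"
proof -
  have "P.expectation (\<lambda>S. Z (S i)) = integral\<^sup>L (distr P D (\<lambda>S. S i)) Z"
    using assms by (intro integral_distr[symmetric]) auto
  also have "distr P D (\<lambda>S. S i) = D"
    using assms by (intro distr_PiM_component D.prob_space_axioms) auto
  finally show ?thesis .
qed

text \<open>Hoeffding for the increments \<open>f y - f z\<close>, which lie in
  \<open>[- B, B]\<close> almost surely. The case \<open>B = 0\<close> is separate because the
  exponent divides by the squared ranges; there the increments vanish almost surely.\<close>

lemma Fbar_diff_upper_tail:
  assumes y: "y \<in> X" "z \<in> X" and c: "c > 0"
  shows "P.prob {S\<in>space P. Fbar f n S y - Fbar f n S z > F y - F z + sqrt (2 * c / real n) * (L * N (y - z))} \<le> exp (- c)"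
proof -
  define B where "B = L * N (y - z)"
  have B0: "B \<ge> 0" using Lip_bound_nonneg y by (simp add: B_def)
  have n0: "real n > 0" using n2 by simp
  define Z where "Z = (\<lambda>s. f y s - f z s)"
  have Z[measurable]: "Z \<in> borel_measurable D" unfolding Z_def using y by measurable
  have EZ: "integral\<^sup>L D Z = F y - F z" unfolding Z_def using fint y by simp
  have bndP: "AE S in P. \<bar>Z (S i)\<bar> \<le> B" if "i < n" for i
    unfolding Z_def B_def by (rule Lip_sample_AE[OF y that])
  have diff: "Fbar f n S y - Fbar f n S z = (\<Sum>i<n. Z (S i)) / real n" for S
    unfolding Z_def by (rule Fbar_diff)
  show ?thesis
  proof (cases "B = 0")
    case True
    have "AE S in P. \<forall>i\<in>{..<n}. Z (S i) = 0"
      using bndP True by (intro AE_finite_allI) auto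
    moreover have "F y - F z = 0"
      using F_Lip[OF y] True unfolding B_def by linarith
    ultimately have "AE S in P. \<not> Fbar f n S y - Fbar f n S z > F y - F z + sqrt (2 * c / real n) * (L * N (y - z))"
      unfolding diff B_def[symmetric] True by (auto elim!: eventually_mono)
    then have "P.prob {S\<in>space P. Fbar f n S y - Fbar f n S z > F y - F z + sqrt (2 * c / real n) * (L * N (y - z))} = 0"
      using y by (subst P.prob_eq_0) auto
    then show ?thesis by simp
  next
    case False
    with B0 have B: "B > 0" by simp
    interpret H: Hoeffding_ineq P "{..<n}" "\<lambda>i S. Z (S i)" "\<lambda>_. - B" "\<lambda>_. B" "\<Sum>i<n. P.expectation (\<lambda>S. Z (S i))"
    proof unfold_locales
      show "AE S in P. Z (S i) \<in> {- B..B}" if "i \<in> {..<n}" for i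
        using bndP[of i] that by (auto elim!: eventually_mono)
    qed (auto intro: indep_sample[OF Z])
    define \<epsilon> where "\<epsilon> = real n * (sqrt (2 * c / real n) * B)"
    have \<epsilon>: "\<epsilon> \<ge> 0" using B c by (simp add: \<epsilon>_def)
    have mu: "(\<Sum>i<n. P.expectation (\<lambda>S. Z (S i))) = real n * (F y - F z)"
      using expectation_sample[OF Z] by (simp add: EZ)
    have "P.prob {S\<in>space P. Fbar f n S y - Fbar f n S z > F y - F z + sqrt (2 * c / real n) * (L * N (y - z))}
        \<le> P.prob {S\<in>space P. (\<Sum>i<n. Z (S i)) \<ge> (\<Sum>i<n. P.expectation (\<lambda>S. Z (S i))) + \<epsilon>}"
    proof (intro P.finite_measure_mono subsetI)
      show "{S\<in>space P. (\<Sum>i<n. Z (S i)) \<ge> (\<Sum>i<n. P.expectation (\<lambda>S. Z (S i))) + \<epsilon>} \<in> P.events"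
        by measurable
    qed (use n0 in \<open>auto simp: mu \<epsilon>_def diff B_def field_simps\<close>)
    also have "\<dots> \<le> exp (- 2 * \<epsilon>\<^sup>2 / (\<Sum>i<n. (B - - B)\<^sup>2))"
      using B n0 \<epsilon> by (intro H.Hoeffding_ineq_ge) auto
    also have "- 2 * \<epsilon>\<^sup>2 / (\<Sum>i<n. (B - - B)\<^sup>2) = - c"
      using B n0 c by (simp add: \<epsilon>_def power_mult_distrib) (simp add: power2_eq_square)
    finally show ?thesis .
  qed
qed

text \<open>The increments \<open>f y - f 0\<close> are almost surely bounded by
  \<open>L * N y\<close> and have sample variance \<open>svar\<close>, so the empirical Bernstein
  bound applies; passing from \<open>L\<close> to \<open>Lhat\<close> only enlarges the
  width.\<close>

lemma Fbar_reliability_width: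
  assumes y: "y \<in> X" and c: "c > 0" and Lhat: "Lhat \<ge> L"
  shows "P.prob {S\<in>space P. \<bar>(Fbar f n S y - Fbar f n S 0) - (F y - F 0)\<bar> > tau N Lhat c f n S y} \<le> 3 * exp (- c)"
proof -
  define B where "B = L * N y"
  have B0: "B \<ge> 0" using Lip_bound_nonneg[OF y zeroX] by (simp add: B_def)
  have n0: "real n > 0" "real n - 1 > 0" using n2 by auto
  define Z where "Z = (\<lambda>s. f y s - f 0 s)"
  have Z[measurable]: "Z \<in> borel_measurable D" unfolding Z_def using y zeroX by measurable
  have EZ: "integral\<^sup>L D Z = F y - F 0" unfolding Z_def using fint y zeroX by simp
  have bndP: "AE S in P. \<bar>Z (S i)\<bar> \<le> B" if "i < n" for i
    unfolding Z_def B_def using Lip_sample_AE[OF y zeroX that] by simp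
  have diff: "Fbar f n S y - Fbar f n S 0 = (\<Sum>i<n. Z (S i)) / real n" for S
    unfolding Z_def by (rule Fbar_diff)
  have BL: "B \<le> Lhat * N y"
    unfolding B_def by (intro mult_right_mono Lhat is_norm_nonneg norm)
  have lin: "c * (14 * B) / (3 * (real n - 1)) \<le> c * (14 * Lhat * N y) / (3 * (real n - 1))"
    using BL c n0 by (intro divide_right_mono mult_left_mono) auto
  let ?E = "{S\<in>space P. \<bar>(Fbar f n S y - Fbar f n S 0) - (F y - F 0)\<bar> > tau N Lhat c f n S y}"
  show ?thesis
  proof (cases "B = 0")
    case True
    have "AE S in P. \<forall>i\<in>{..<n}. Z (S i) = 0"
      using bndP True by (intro AE_finite_allI) auto
    moreover have "F y - F 0 = 0"
      using F_Lip[OF y zeroX] True unfolding B_def by (auto simp del: mult_eq_0_iff)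
    moreover have "tau N Lhat c f n S y \<ge> 0" for S
      unfolding tau_def using lin True c n0 by (intro add_nonneg_nonneg) (auto intro!: divide_nonneg_nonneg mult_nonneg_nonneg svar_nonneg n2)
    ultimately have "AE S in P. \<not> \<bar>(Fbar f n S y - Fbar f n S 0) - (F y - F 0)\<bar> > tau N Lhat c f n S y"
      unfolding diff by (auto elim!: eventually_mono simp: not_less)
    then have "P.prob ?E = 0"
      using y zeroX by (subst P.prob_eq_0) auto
    then show ?thesis by simp
  next
    case False
    with B0 have B: "B > 0" by simp
    interpret Y: bounded_sample P "\<lambda>i S. Z (S i)" n B "F y - F 0" "integral\<^sup>L D (\<lambda>s. (Z s)\<^sup>2) - (F y - F 0)\<^sup>2"
      using expectation_sample[OF Z] expectation_sample[of "\<lambda>s. (Z s)\<^sup>2"] EZ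
      by unfold_locales (auto simp: n2 B bndP intro: indep_sample[OF Z])
    have avg: "Y.avg S = Fbar f n S y - Fbar f n S 0" for S
      by (simp add: Y.avg_def diff)
    have svr: "Y.svr S = svar f n S y" for S
      unfolding Y.svr_def avg svar_def by (simp add: Z_def)
    have "P.prob ?E \<le> P.prob {S\<in>space P. \<bar>Y.avg S - (F y - F 0)\<bar> \<ge> sqrt (2 * c * Y.svr S / real n) + c * (14 * B) / (3 * (real n - 1))}"
    proof (rule P.finite_measure_mono)
      show "{S\<in>space P. \<bar>Y.avg S - (F y - F 0)\<bar> \<ge> sqrt (2 * c * Y.svr S / real n) + c * (14 * B) / (3 * (real n - 1))} \<in> sets P"
        by measurable
    qed (use lin in \<open>auto simp: avg svr tau_def\<close>)
    also have "\<dots> \<le> 3 * exp (- c)"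
      by (rule Y.empirical_Bernstein[OF c])
    finally show ?thesis .
  qed
qed

text \<open>Three quarters of the failure probability pay for the validity of the widths; one quarter is
  left for events \<open>G\<close> chosen by the caller.\<close>
lemma valid_widths_event:
  fixes x :: "nat \<Rightarrow> 'a" and K :: nat and J :: "'j set" and G :: "'j \<Rightarrow> (nat \<Rightarrow> 's) set"
  assumes x: "\<And>k. k \<le> K \<Longrightarrow> x k \<in> X" and x0: "x 0 = 0" and c: "c > 0" and Lhat: "Lhat \<ge> L"
    and J: "finite J" "card J \<le> K"
    and G: "\<And>j. j \<in> J \<Longrightarrow> G j \<in> sets P" "\<And>j. j \<in> J \<Longrightarrow> P.prob (G j) \<le> exp (- c)"
  obtains A where "A \<in> sets P" "P.prob A \<ge> 1 - 4 * real K * exp (- c)"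
    and "\<And>S. S \<in> A \<Longrightarrow> S \<in> space P"
    and "\<And>S k. S \<in> A \<Longrightarrow> k \<le> K \<Longrightarrow> \<bar>(Fbar f n S (x k) - Fbar f n S (x 0)) - (F (x k) - F (x 0))\<bar> \<le> tau N Lhat c f n S (x k)"
    and "\<And>S k j i. S \<in> A \<Longrightarrow> k \<le> K \<Longrightarrow> j \<le> K \<Longrightarrow> i < n \<Longrightarrow> \<bar>f (x k) (S i) - f (x j) (S i)\<bar> \<le> L * N (x k - x j)"
    and "\<And>S j. S \<in> A \<Longrightarrow> j \<in> J \<Longrightarrow> S \<notin> G j"
proof -
  define E where "E = (\<lambda>k. {S\<in>space P. \<bar>(Fbar f n S (x k) - Fbar f n S 0) - (F (x k) - F 0)\<bar> > tau N Lhat c f n S (x k)})"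
  \<comment> \<open>Restricting the Lipschitz inequality to the finitely many candidates yields a
    measurable almost sure event.\<close>
  define Q where "Q = {S\<in>space P. \<forall>k\<in>{..K}. \<forall>j\<in>{..K}. \<forall>i\<in>{..<n}. \<bar>f (x k) (S i) - f (x j) (S i)\<bar> \<le> L * N (x k - x j)}"
  have Em: "E k \<in> sets P" if "k \<in> {1..K}" for k
    unfolding E_def using x[of k] that zeroX by auto
  have Qm: "Q \<in> sets P"
  proof -
    have [measurable]: "(\<lambda>S. f (x k) (S i)) \<in> borel_measurable P" if "k \<le> K" "i < n" for k i
      by (rule measurable_compose[OF measurable_component_singleton]) (use x that in auto)
    then show ?thesis
      unfolding Q_def by (intro sets.sets_Collect_finite_All borel_measurable_le) auto
  qed
  have "AE S in P. S \<in> Q"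
  proof -
    have "AE S in P. \<forall>k\<in>{..K}. \<forall>j\<in>{..K}. \<forall>i\<in>{..<n}. \<bar>f (x k) (S i) - f (x j) (S i)\<bar> \<le> L * N (x k - x j)"
      by (intro AE_finite_allI Lip_sample_AE x) auto
    then show ?thesis using AE_space by eventually_elim (auto simp: Q_def)
  qed
  then have Q1: "P.prob Q = 1"
    using P.prob_eq_1[OF Qm] by simp
  have EUm: "(\<Union>k\<in>{1..K}. E k) \<in> sets P" and GUm: "(\<Union>j\<in>J. G j) \<in> sets P"
    using Em G(1) J by (intro sets.finite_UN; auto)+
  \<comment> \<open>Indices start at 1: candidate 0 has zero width and zero deviation. The cost is
    \<open>3 * K\<close> for the widths and at most \<open>K\<close> for \<open>G\<close>, in units
    of \<open>exp (- c)\<close>.\<close>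
  define U where "U = (\<Union>k\<in>{1..K}. E k) \<union> (\<Union>j\<in>J. G j) \<union> (space P - Q)"
  have Um: "U \<in> sets P"
    unfolding U_def using EUm GUm Qm by auto
  have "P.prob U \<le> P.prob (\<Union>k\<in>{1..K}. E k) + P.prob (\<Union>j\<in>J. G j) + P.prob (space P - Q)"
    unfolding U_def using EUm GUm Qm
    by (intro order_trans[OF measure_Un_le] add_right_mono measure_Un_le) auto
  also have "P.prob (\<Union>k\<in>{1..K}. E k) \<le> (\<Sum>k\<in>{1..K}. P.prob (E k))"
    using Em by (intro measure_UNION_le) auto
  also have "\<dots> \<le> (\<Sum>k\<in>{1..K}. 3 * exp (- c))"
    unfolding E_def using x by (intro sum_mono Fbar_reliability_width c Lhat) auto
  also have "P.prob (\<Union>j\<in>J. G j) \<le> (\<Sum>j\<in>J. P.prob (G j))"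
    using G J by (intro measure_UNION_le) auto
  also have "\<dots> \<le> (\<Sum>j\<in>J. exp (- c))"
    by (intro sum_mono G)
  also have "\<dots> \<le> real K * exp (- c)"
    using J by simp
  also have "P.prob (space P - Q) = 0"
    using P.prob_compl[OF Qm] Q1 by simp
  finally have "P.prob U \<le> 4 * real K * exp (- c)" by simp
  then have prob: "P.prob (space P - U) \<ge> 1 - 4 * real K * exp (- c)"
    using P.prob_compl[OF Um] by simp
  show ?thesis
  proof (rule that[of "space P - U"])
    fix S k assume S: "S \<in> space P - U" and k: "k \<le> K"
    show "\<bar>(Fbar f n S (x k) - Fbar f n S (x 0)) - (F (x k) - F (x 0))\<bar> \<le> tau N Lhat c f n S (x k)"
    proof (cases "k = 0")
      case True
      then show ?thesis by (simp add: x0 tau_zero[OF norm])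
    next
      case False
      then have "S \<notin> E k" using S k by (auto simp: U_def)
      then show ?thesis using S by (simp add: E_def x0)
    qed
  qed (use Um prob in \<open>auto simp: U_def Q_def\<close>)
qed

end

section \<open>Combination of the concentration events with the selection rule\<close>

theorem theorem1:
  fixes N :: "real^'d \<Rightarrow> real"
    and X :: "(real^'d) set"
    and D :: "'s measure"
    and f :: "real^'d \<Rightarrow> 's \<Rightarrow> real"
    and n K :: nat
    and L Lhat \<delta> \<gamma> \<mu> :: real
    and x :: "nat \<Rightarrow> real^'d"
  defines "P \<equiv> PiM {..<n} (\<lambda>_. D)"
    and "F \<equiv> (\<lambda>y. integral\<^sup>L D (f y))"
    and "c \<equiv> ln (4 * real K / \<delta>)"
  assumes norm: "is_norm N"
    and Xclosed: "closed X" and Xconvex: "convex X" and zeroX: "0 \<in> X"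
    and D: "prob_space D"
    and n2: "n \<ge> 2"
    and fconv: "\<forall>s\<in>space D. convex_on X (\<lambda>y. f y s)"
    and fint: "\<forall>y\<in>X. integrable D (f y)"
    and Lip: "AE s in D. \<forall>y\<in>X. \<forall>y'\<in>X. \<bar>f y s - f y' s\<bar> \<le> L * N (y - y')"
    and Lhat: "Lhat \<ge> L"
    and K1: "K \<ge> 1"
    and x0: "x 0 = 0" and xX: "\<forall>k\<in>{1..K}. x k \<in> X"
    and \<delta>: "0 < \<delta>" "\<delta> < 1"
    and \<gamma>: "\<gamma> \<ge> 1"
  shows
    "(\<exists>A\<in>sets P. prob_space.prob P A \<ge> 1 - \<delta> \<and>
        (\<forall>S\<in>A. \<forall>kr. rms_output (\<lambda>k. Fbar f n S (x k)) (\<lambda>k. tau N Lhat c f n S (x k)) \<gamma> K kr \<longrightarrow>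
           (\<forall>k\<le>K. F (x kr) \<le> F (x k) + (1 + \<gamma>) *
              (sqrt (2 * c) * L * N (x k) / sqrt (real n) + 14 * c / 3 * (Lhat * N (x k) / real n)))))
     \<and>
     (\<mu> > 0 \<and> strongly_convex_wrt N X F \<mu> \<and> \<gamma> \<ge> 3 \<longrightarrow>
      (\<exists>A\<in>sets P. prob_space.prob P A \<ge> 1 - \<delta> \<and>
        (\<forall>S\<in>A. \<forall>kr. rms_output (\<lambda>k. Fbar f n S (x k)) (\<lambda>k. tau N Lhat c f n S (x k)) \<gamma> K kr \<longrightarrow>
           F (x kr) - (INF y\<in>X. integral\<^sup>L D (f y)) \<le> 4 * (Min ((\<lambda>k. F (x k)) ` {..K}) - (INF y\<in>X. integral\<^sup>L D (f y)))
             + 128 / \<mu> * (2 * L * sqrt (2 * c / (real n - 1)) + 14 * Lhat * c / (3 * real n))\<^sup>2)))"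
proof -
  interpret lipschitz_sample D N X f n L
    rewrites "PiM {..<n} (\<lambda>_. D) \<equiv> P" and "\<And>y. integral\<^sup>L D (f y) \<equiv> F y"
    using D norm n2 zeroX fint Lip
    by (auto simp: lipschitz_sample_def lipschitz_sample_axioms_def P_def F_def)
  have INF: "(INF y\<in>X. integral\<^sup>L D (f y)) = (INF y\<in>X. F y)"
    by (simp add: F_def)
  have n0: "real n > 0" "real n - 1 > 0" "real n \<ge> 2" using n2 by auto
  have x: "x k \<in> X" if "k \<le> K" for k
    using that xX x0 zeroX by (cases "k = 0") auto
  have K0: "real K > 0" using K1 by simp
  \<comment> \<open>Since \<open>4 * K / \<delta>\<close> is at least 4, \<open>c\<close> exceeds 1,
    as the comparison of widths requires.\<close>
  have "exp 1 < (4::real)"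
    using exp_le by simp
  also have "4 \<le> 4 * real K / \<delta>"
    using \<delta> K1 mult_mono[of 1 "real K" \<delta> 1] by (simp add: le_divide_eq)
  finally have c1: "c > 1"
    using ln_less_cancel_iff[of "exp 1" "4 * real K / \<delta>"] K0 \<delta> by (simp add: c_def)
  have exp_c: "4 * real K * exp (- c) = \<delta>"
    using K0 \<delta> by (simp add: c_def exp_minus)
  define h where "h = sqrt (2 * c / real n)"
  define h' where "h' = sqrt (2 * c / (real n - 1))"
  have h0: "0 \<le> h" "h \<le> h'"
    using n0 c1 by (auto simp: h_def h'_def intro!: divide_left_mono)
  have part1: "\<exists>A\<in>sets P. P.prob A \<ge> 1 - \<delta> \<and>
        (\<forall>S\<in>A. \<forall>kr. rms_output (\<lambda>k. Fbar f n S (x k)) (\<lambda>k. tau N Lhat c f n S (x k)) \<gamma> K kr \<longrightarrow>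
           (\<forall>k\<le>K. F (x kr) \<le> F (x k) + (1 + \<gamma>) *
              (sqrt (2 * c) * L * N (x k) / sqrt (real n) + 14 * c / 3 * (Lhat * N (x k) / real n))))"
  proof -
    \<comment> \<open>Bounding this deviation by Hoeffding rather than by the width keeps the scale
      \<open>n\<close>, and leaves the gap that absorbs the excess of \<open>tau\<close>.\<close>
    define G where "G = (\<lambda>k. {S\<in>space P. Fbar f n S (x k) - Fbar f n S 0 > F (x k) - F 0 + h * (L * N (x k - 0))})"
    have Gm: "G k \<in> sets P" and Gp: "P.prob (G k) \<le> exp (- c)" if k: "k \<in> {1..K}" for k
    proof -
      have xk: "x k \<in> X" using k x by auto
      show "G k \<in> sets P"
        unfolding G_def using Fbar_measurable[OF xk] Fbar_measurable[OF zeroX] by measurable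
      show "P.prob (G k) \<le> exp (- c)"
        unfolding G_def h_def using c1 by (intro Fbar_diff_upper_tail[OF xk zeroX]) simp
    qed
    obtain A where A: "A \<in> sets P" "P.prob A \<ge> 1 - \<delta>"
      and AS: "\<And>S. S \<in> A \<Longrightarrow> S \<in> space P"
      and rel: "\<And>S k. S \<in> A \<Longrightarrow> k \<le> K \<Longrightarrow> \<bar>(Fbar f n S (x k) - Fbar f n S (x 0)) - (F (x k) - F (x 0))\<bar> \<le> tau N Lhat c f n S (x k)"
      and bnd: "\<And>S k j i. S \<in> A \<Longrightarrow> k \<le> K \<Longrightarrow> j \<le> K \<Longrightarrow> i < n \<Longrightarrow> \<bar>f (x k) (S i) - f (x j) (S i)\<bar> \<le> L * N (x k - x j)"
      and dev: "\<And>S k. S \<in> A \<Longrightarrow> k \<in> {1..K} \<Longrightarrow> S \<notin> G k"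
      by (rule valid_widths_event[of K x c Lhat "{1..K}" G, unfolded exp_c]) (use x x0 c1 Lhat Gm Gp in auto)
    have "F (x kr) \<le> F (x k) + (1 + \<gamma>) *
              (sqrt (2 * c) * L * N (x k) / sqrt (real n) + 14 * c / 3 * (Lhat * N (x k) / real n))"
      if S: "S \<in> A" and k: "k \<le> K"
        and out: "rms_output (\<lambda>k. Fbar f n S (x k)) (\<lambda>k. tau N Lhat c f n S (x k)) \<gamma> K kr" for S kr k
    proof -
      note kr = rms_outputD[OF out]
      define M M' t W where "M = L * N (x k)" and "M' = Lhat * N (x k)" and "t = tau N Lhat c f n S (x k)"
        and "W = sqrt (2 * c / real n) * M + 14 * c * M' / (3 * real n)"
      have M: "0 \<le> M" using Lip_bound_nonneg[OF x[OF k] zeroX] by (simp add: M_def)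
      have MM': "M \<le> M'" unfolding M_def M'_def by (intro mult_right_mono Lhat is_norm_nonneg norm)
      have "t \<le> sqrt (2 * c / (real n - 1)) * M + 14 * c * M' / (3 * (real n - 1))"
        using tau_le[OF n2 _ M, of c f "x k" S 0 Lhat N M'] bnd[OF S k, of 0] c1
        by (simp add: x0 M_def M'_def t_def tau_zero[OF norm] norm)
      then have alt: "M \<le> (1 + \<gamma>) * W \<or> h * M + \<gamma> * t \<le> (1 + \<gamma>) * W"
        unfolding W_def h_def by (intro width_bound_or_trivial n0 c1 M MM' \<gamma>)
      have "F (x kr) \<le> F (x k) + (1 + \<gamma>) * W"
        using alt
      proof
        \<comment> \<open>Candidate 0 has zero width, so the selected point is never worse than 0,
          and 0 is at most \<open>M\<close> worse than \<open>x k\<close>.\<close>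
        assume *: "M \<le> (1 + \<gamma>) * W"
        have "Fbar f n S (x kr) + tau N Lhat c f n S (x kr) \<le> Fbar f n S (x 0)"
          using kr(2)[of 0] by (simp add: x0 tau_zero[OF norm])
        then have "F (x kr) \<le> F 0"
          using rel[OF S kr(1)] x0 by (simp add: abs_le_iff)
        also have "F 0 \<le> F (x k) + M"
          using F_Lip[OF x[OF k] zeroX] by (simp add: M_def abs_le_iff)
        finally show ?thesis using * by linarith
      next
        assume *: "h * M + \<gamma> * t \<le> (1 + \<gamma>) * W"
        have "Fbar f n S (x k) - Fbar f n S 0 \<le> F (x k) - F 0 + h * M"
        proof (cases "k = 0")
          case True
          then show ?thesis using h0 M by (simp add: x0)
        next
          case False
          then show ?thesis using dev[OF S, of k] k AS[OF S] by (simp add: G_def M_def not_less)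
        qed
        then show ?thesis
          using * kr(2)[OF k] rel[OF S kr(1)] x0 by (simp add: t_def abs_le_iff)
      qed
      also have "W = sqrt (2 * c) * L * N (x k) / sqrt (real n) + 14 * c / 3 * (Lhat * N (x k) / real n)"
        by (simp add: W_def M_def M'_def real_sqrt_divide)
      finally show ?thesis .
    qed
    then show ?thesis using A by blast
  qed
  have part2: "\<exists>A\<in>sets P. P.prob A \<ge> 1 - \<delta> \<and>
        (\<forall>S\<in>A. \<forall>kr. rms_output (\<lambda>k. Fbar f n S (x k)) (\<lambda>k. tau N Lhat c f n S (x k)) \<gamma> K kr \<longrightarrow>
           F (x kr) - (INF y\<in>X. F y) \<le> 4 * (Min ((\<lambda>k. F (x k)) ` {..K}) - (INF y\<in>X. F y))
             + 128 / \<mu> * (2 * L * sqrt (2 * c / (real n - 1)) + 14 * Lhat * c / (3 * real n))\<^sup>2)"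
    if \<mu>: "\<mu> > 0" and sc: "strongly_convex_wrt N X F \<mu>" and \<gamma>3: "\<gamma> \<ge> 3"
  proof -
    have Fconv: "convex_on X F"
    proof (rule convex_onI[OF _ Xconvex])
      fix t y z assume t: "0 < t" "t < (1::real)" and yz: "y \<in> X" "z \<in> X"
      have m: "(1 - t) *\<^sub>R y + t *\<^sub>R z \<in> X"
        using Xconvex t yz by (intro convexD) auto
      have "integral\<^sup>L D (f ((1 - t) *\<^sub>R y + t *\<^sub>R z)) \<le> integral\<^sup>L D (\<lambda>s. (1 - t) * f y s + t * f z s)"
        using fint m yz fconv t by (intro integral_mono) (auto intro: convex_onD)
      also have "\<dots> = (1 - t) * F y + t * F z"
        using fint yz by (simp add: F_def)
      finally show "F ((1 - t) *\<^sub>R y + t *\<^sub>R z) \<le> (1 - t) * F y + t * F z"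
        by (simp add: F_def)
    qed
    obtain w where w: "w \<in> X" "\<And>y. y \<in> X \<Longrightarrow> F w \<le> F y"
      using strongly_convex_attains_inf[OF norm Xclosed _ Fconv F_Lip sc \<mu>] zeroX by blast
    have Fs: "(INF y\<in>X. F y) = F w"
      using w by (intro cInf_eq_minimum) auto
    have "Min ((\<lambda>k. F (x k)) ` {..K}) \<in> (\<lambda>k. F (x k)) ` {..K}"
      by (intro Min_in) auto
    then obtain ks where ks: "ks \<le> K" and Fks: "Min ((\<lambda>k. F (x k)) ` {..K}) = F (x ks)"
      by (elim imageE) simp
    \<comment> \<open>\<open>ks\<close> is determined by \<open>F\<close> and not by the sample, so
      Hoeffding applies to fixed points. Leaving out \<open>ks\<close> itself keeps the number of
      events at \<open>K\<close>.\<close>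
    define G where "G = (\<lambda>k. {S\<in>space P. Fbar f n S (x ks) - Fbar f n S (x k) > F (x ks) - F (x k) + h * (L * N (x ks - x k))})"
    have Gm: "G k \<in> sets P" and Gp: "P.prob (G k) \<le> exp (- c)" if k: "k \<in> {..K} - {ks}" for k
    proof -
      have xk: "x k \<in> X" using k x by auto
      show "G k \<in> sets P"
        unfolding G_def using Fbar_measurable[OF xk] Fbar_measurable[OF x[OF ks]] by measurable
      show "P.prob (G k) \<le> exp (- c)"
        unfolding G_def h_def using c1 by (intro Fbar_diff_upper_tail[OF x[OF ks] xk]) simp
    qed
    obtain A where A: "A \<in> sets P" "P.prob A \<ge> 1 - \<delta>"
      and AS: "\<And>S. S \<in> A \<Longrightarrow> S \<in> space P"
      and rel: "\<And>S k. S \<in> A \<Longrightarrow> k \<le> K \<Longrightarrow> \<bar>(Fbar f n S (x k) - Fbar f n S (x 0)) - (F (x k) - F (x 0))\<bar> \<le> tau N Lhat c f n S (x k)"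
      and bnd: "\<And>S k j i. S \<in> A \<Longrightarrow> k \<le> K \<Longrightarrow> j \<le> K \<Longrightarrow> i < n \<Longrightarrow> \<bar>f (x k) (S i) - f (x j) (S i)\<bar> \<le> L * N (x k - x j)"
      and dev: "\<And>S k. S \<in> A \<Longrightarrow> k \<in> {..K} - {ks} \<Longrightarrow> S \<notin> G k"
      by (rule valid_widths_event[of K x c Lhat "{..K} - {ks}" G, unfolded exp_c]) (use x x0 c1 Lhat ks Gm Gp in auto)
    define q where "q = 2 * L * sqrt (2 * c / (real n - 1)) + 14 * Lhat * c / (3 * real n)"
    have "F (x kr) - F w \<le> 4 * (F (x ks) - F w) + 128 / \<mu> * q\<^sup>2"
      if S: "S \<in> A" and out: "rms_output (\<lambda>k. Fbar f n S (x k)) (\<lambda>k. tau N Lhat c f n S (x k)) \<gamma> K kr" for S kr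
    proof (cases "L \<ge> 0")
      \<comment> \<open>For negative \<open>L\<close> the Lipschitz bound forces all candidates to
        coincide.\<close>
      case False
      have "x kr = x ks"
        using Lip_bound_nonneg[OF x[OF rms_outputD(1)[OF out]] x[OF ks]] False
          is_norm_nonneg[OF norm, of "x kr - x ks"] norm
        by (auto simp: zero_le_mult_iff is_norm_def)
      moreover have "F (x ks) - F w \<ge> 0" using w(2)[OF x[OF ks]] by simp
      moreover have "128 / \<mu> * q\<^sup>2 \<ge> 0" using \<mu> by simp
      ultimately show ?thesis by simp
    next
      case True
      define \<rho> where "\<rho> = h' * L + 14 * c * Lhat / (3 * (real n - 1))"
      have Lh: "Lhat \<ge> 0" using True Lhat by simp
      have \<rho>0: "\<rho> \<ge> 0" using True Lh h0 c1 n0 by (simp add: \<rho>_def)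
      have hL: "h * L \<ge> 0" using True h0 by simp
      have "F (x kr) - F w \<le> 4 * (F (x ks) - F w) + 4 / \<mu> * (h * L + \<rho>)\<^sup>2"
      proof (rule rms_output_vs_best[OF out \<gamma>3 \<mu> ks rel[OF S] _ _ _ _ hL \<rho>0, where d = "\<lambda>k. N (x ks - x k)" and e = "\<lambda>k. N (x k - w)"])
        fix k assume k: "k \<le> K"
        show "Fbar f n S (x ks) - Fbar f n S (x k) \<le> F (x ks) - F (x k) + h * L * N (x ks - x k)"
        proof (cases "k = ks")
          case True
          then show ?thesis by (simp add: norm)
        next
          case False
          then show ?thesis using dev[OF S, of k] k AS[OF S] by (simp add: G_def not_less mult.assoc)
        qed
        have "tau N Lhat c f n S (x ks) \<le> tau N Lhat c f n S (x k)
            + (sqrt (2 * c / (real n - 1)) * (L * N (x ks - x k)) + 14 * c * (Lhat * N (x ks - x k)) / (3 * (real n - 1)))"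
        proof (rule tau_le[where M = "L * N (x ks - x k)"])
          show "Lhat * N (x ks) \<le> Lhat * N (x k) + Lhat * N (x ks - x k)"
            using mult_left_mono[OF is_norm_diff_le[OF norm, of "x ks" "x k"] Lh] by (simp add: algebra_simps)
        qed (use c1 n2 Lip_bound_nonneg[OF x[OF ks] x[OF k]] bnd[OF S ks k] in auto)
        also have "\<dots> = tau N Lhat c f n S (x k) + \<rho> * N (x ks - x k)"
          by (simp add: \<rho>_def h'_def algebra_simps)
        finally show "tau N Lhat c f n S (x ks) \<le> \<dots>" .
        show "N (x ks - x k) \<le> N (x k - w) + N (x ks - w)"
          using is_norm_triangle[OF norm, of "x ks - w" "w - x k"] is_norm_minus_commute[OF norm, of w "x k"] by simp
        show "F w + \<mu> / 2 * (N (x k - w))\<^sup>2 \<le> F (x k)"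
          by (rule strongly_convex_quadratic_growth[OF sc w x[OF k]])
      qed
      \<comment> \<open>The linear part of \<open>\<rho>\<close> has \<open>n - 1\<close> where
        \<open>q\<close> has \<open>n\<close>; \<open>n - 1 \<ge> n / 2\<close> costs a factor
        2.\<close>
      moreover have "(h * L + \<rho>)\<^sup>2 \<le> (2 * q)\<^sup>2"
      proof (rule power_mono)
        have "h * L \<le> h' * L" using True h0 by (intro mult_right_mono)
        moreover have "h' * L \<ge> 0" using True h0 by simp
        moreover have "14 * c * Lhat / (3 * (real n - 1)) \<le> 2 * (14 * Lhat * c / (3 * real n))"
        proof -
          have "14 * c * Lhat / (3 * (real n - 1)) \<le> 14 * c * Lhat / (3 * (real n / 2))"
            using n0 c1 Lh by (intro divide_left_mono) auto
          then show ?thesis by (simp add: mult_ac)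
        qed
        moreover have "q = 2 * (h' * L) + 14 * Lhat * c / (3 * real n)"
          by (simp add: q_def h'_def)
        ultimately show "h * L + \<rho> \<le> 2 * q"
          unfolding \<rho>_def by linarith
      qed (use hL \<rho>0 in simp)
      \<comment> \<open>The stated constant is \<open>128 = 4 * 32\<close>, and
        \<open>(2 * q)^2 = 4 * q^2\<close> lies below \<open>32 * q^2\<close>.\<close>
      then have "(h * L + \<rho>)\<^sup>2 \<le> 32 * q\<^sup>2"
        using zero_le_power2[of q] unfolding power_mult_distrib power2_eq_square[of 2] by linarith
      then have "4 / \<mu> * (h * L + \<rho>)\<^sup>2 \<le> 4 / \<mu> * (32 * q\<^sup>2)"
        using \<mu> by (intro mult_left_mono) auto
      ultimately show ?thesis by simp
    qed
    then show ?thesis using A unfolding Fs Fks q_def by blast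
  qed
  show ?thesis
    unfolding INF using part1 part2 by blast
qed

end
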